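(* Let $\Omega\subset\mathbb R^N$ be a smooth bounded domain, $\kappa>0$, $r>0$, and let $u_0\in\overline{D_r}^{L^2}$ (the closure of $D_r$ in $L^2(\Omega)$). Let $u$ be the unique solution of (P) such that $u$ also solves the obstacle problem (OP). Assume $u_0\in L^\infty(\Omega)$. Then it holds that $$u_0(x)\le u(x,t)\le\max\left\{\sqrt{\kappa},\|u_0\|_{L^\infty(\Omega)}\right\}\quad\text{a.e. in }\Omega\times(0,\infty),$$ and hence $u\in L^\infty(\Omega\times(0,\infty))$.
   Context: $\|\cdot\|_p$ is the $L^p(\Omega)$-norm; $(s)_+:=\max\{s,0\}$, $(s)_-:=\max\{-s,0\}\ge0$. For $a\in\mathbb R$: $\partial I_{[a,\infty)}(s)=\{0\}$ if $s>a$, $(-\infty,0]$ if $s=a$, $\emptyset$ if $s<a$. Problem (P): $u_t=\big(\Delta u-u^3+\kappa u\big)_+$ in $\Omega\times(0,\infty)$, $u=0$ on $\partial\Omega\times(0,\infty)$, $u(\cdot,0)=u_0$. A function $u\in C([0,\infty);L^2(\Omega))$ is a solution of (P) if: (1) $u$ belongs to $W^{1,2}(\delta,T;L^2(\Omega))$, $C([\delta,T];H^1_0(\Omega)\cap L^4(\Omega))$, $L^2(\delta,T;H^2(\Omega))$ and $L^6(\delta,T;L^6(\Omega))$ for any $0<\delta<T<\infty$; (2) there exists $\eta\in L^\infty(0,\infty;L^2(\Omega))$ such that $u_t+\eta-\Delta u+u^3-\kappa u=0$, $\eta\in\partial I_{[0,\infty)}(u_t)$ and $\eta=-(\Delta u-u^3+\kappa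 u)_-$ a.e. in $\Omega\times(0,\infty)$; (3) $u(\cdot,0)=u_0$ a.e. in $\Omega$. Obstacle problem (OP): $u_t+\partial I_{[u_0(x),\infty)}(u)-\Delta u+u^3-\kappa u\ni0$ in $\Omega\times(0,\infty)$, $u=0$ on $\partial\Omega\times(0,\infty)$, $u(\cdot,0)=u_0$; a solution is a $u\in C([0,\infty);L^2(\Omega))$ with regularity (1), $u(\cdot,0)=u_0$, for which there is $\eta\in L^\infty(0,\infty;L^2(\Omega))$ with $u_t+\eta-\Delta u+u^3-\kappa u=0$ and $\eta\in\partial I_{[u_0(x),\infty)}(u)$ a.e. in $\Omega\times(0,\infty)$. It is known that for $u_0\in\overline{D_r}^{L^2}$ there is exactly one solution of (P) which also solves (OP). $D_r:=\{u\in H^2(\Omega)\cap H^1_0(\Omega)\cap L^6(\Omega)\colon \|(\Delta u-u^3+\kappa u)_-\|_2^2\le r\}$. *)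

theory Defs
  imports "HOL-Analysis.Analysis" "HOL-Probability.Essential_Supremum"
begin

text \<open>
  Elements of Lebesgue and Sobolev spaces are represented by functions on the whole ambient space,
  of which only the values almost everywhere in the domain matter.  The norms below are seminorms
  on these representatives and are meaningful only on the space they belong to.
\<close>

section \<open>Smooth functions and domains\<close>

definition partial_deriv :: "'a::euclidean_space \<Rightarrow> ('a \<Rightarrow> real) \<Rightarrow> 'a \<Rightarrow> real" where
  "partial_deriv i f x = frechet_derivative f (at x) i"

text \<open>Intended for open sets \<open>S\<close>.\<close>

fun C_k_on :: "nat \<Rightarrow> 'a::euclidean_space set \<Rightarrow> ('a \<Rightarrow> real) \<Rightarrow> bool" where
  "C_k_on 0 S f \<longleftrightarrow> continuous_on S f"
| "C_k_on (Suc k) S f \<longleftrightarrow>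
     (\<forall>x\<in>S. f differentiable (at x)) \<and> (\<forall>i\<in>Basis. C_k_on k S (partial_deriv i f))"

definition smooth_on :: "'a::euclidean_space set \<Rightarrow> ('a \<Rightarrow> real) \<Rightarrow> bool" where
  "smooth_on S f \<longleftrightarrow> (\<forall>k. C_k_on k S f)"

definition test_functions :: "'a::euclidean_space set \<Rightarrow> ('a \<Rightarrow> real) set" where
  "test_functions S = {\<phi>. smooth_on UNIV \<phi> \<and>
     compact (closure {x. \<phi> x \<noteq> 0}) \<and> closure {x. \<phi> x \<noteq> 0} \<subseteq> S}"

text \<open>
  Near every boundary point the domain is, in suitable orthonormal coordinates with last axis
  \<open>e\<close>, the part above the graph of a smooth function \<open>\<gamma>\<close> of the remaining coordinates; these
  are the coordinates of the orthogonal projection \<open>y - (y \<bullet> e) *\<^sub>R e\<close>.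
\<close>

definition smooth_bounded_domain :: "'a::euclidean_space set \<Rightarrow> bool" where
  "smooth_bounded_domain \<Omega> \<longleftrightarrow>
     open \<Omega> \<and> connected \<Omega> \<and> \<Omega> \<noteq> {} \<and> bounded \<Omega> \<and>
     (\<forall>z\<in>frontier \<Omega>. \<exists>\<rho>>0. \<exists>e \<gamma>. norm e = 1 \<and> smooth_on UNIV \<gamma> \<and>
        \<Omega> \<inter> ball z \<rho> = {y \<in> ball z \<rho>. y \<bullet> e > \<gamma> (y - (y \<bullet> e) *\<^sub>R e)})"

section \<open>Lebesgue and Sobolev spaces\<close>

definition L_space :: "real \<Rightarrow> 'a::euclidean_space set \<Rightarrow> ('a \<Rightarrow> real) set" where
  "L_space p \<Omega> = {f \<in> borel_measurable (lebesgue_on \<Omega>).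
     integrable (lebesgue_on \<Omega>) (\<lambda>x. \<bar>f x\<bar> powr p)}"

definition L_norm :: "real \<Rightarrow> 'a::euclidean_space set \<Rightarrow> ('a \<Rightarrow> real) \<Rightarrow> real" where
  "L_norm p \<Omega> f = (LINT x|lebesgue_on \<Omega>. \<bar>f x\<bar> powr p) powr (1 / p)"

definition Linf_space :: "'a::euclidean_space set \<Rightarrow> ('a \<Rightarrow> real) set" where
  "Linf_space \<Omega> = {f \<in> borel_measurable (lebesgue_on \<Omega>).
     \<exists>C. AE x in lebesgue_on \<Omega>. \<bar>f x\<bar> \<le> C}"

definition Linf_norm :: "'a::euclidean_space set \<Rightarrow> ('a \<Rightarrow> real) \<Rightarrow> real" where
  "Linf_norm \<Omega> f = real_of_ereal (esssup (lebesgue_on \<Omega>) (\<lambda>x. ereal \<bar>f x\<bar>))"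

definition closure_wrt ::
    "('a \<Rightarrow> real) set \<Rightarrow> (('a \<Rightarrow> real) \<Rightarrow> real) \<Rightarrow> ('a \<Rightarrow> real) set \<Rightarrow> ('a \<Rightarrow> real) set" where
  "closure_wrt X nrm A = {f \<in> X. \<forall>\<epsilon>>0. \<exists>g\<in>A. nrm (\<lambda>x. f x - g x) < \<epsilon>}"

definition locally_integrable :: "'a::euclidean_space set \<Rightarrow> ('a \<Rightarrow> real) \<Rightarrow> bool" where
  "locally_integrable \<Omega> f \<longleftrightarrow> (\<forall>K. compact K \<longrightarrow> K \<subseteq> \<Omega> \<longrightarrow> set_integrable lebesgue K f)"

definition has_weak_partial ::
    "'a::euclidean_space set \<Rightarrow> 'a \<Rightarrow> ('a \<Rightarrow> real) \<Rightarrow> ('a \<Rightarrow> real) \<Rightarrow> bool" where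
  "has_weak_partial \<Omega> i f g \<longleftrightarrow> locally_integrable \<Omega> f \<and> locally_integrable \<Omega> g \<and>
     (\<forall>\<phi>\<in>test_functions \<Omega>.
        (LINT x|lebesgue_on \<Omega>. f x * partial_deriv i \<phi> x) = - (LINT x|lebesgue_on \<Omega>. g x * \<phi> x))"

text \<open>An arbitrary representative; weak derivatives are unique only almost everywhere in \<open>\<Omega>\<close>.\<close>

definition weak_partial :: "'a::euclidean_space set \<Rightarrow> 'a \<Rightarrow> ('a \<Rightarrow> real) \<Rightarrow> 'a \<Rightarrow> real" where
  "weak_partial \<Omega> i f = (SOME g. has_weak_partial \<Omega> i f g)"

definition laplacian :: "'a::euclidean_space set \<Rightarrow> ('a \<Rightarrow> real) \<Rightarrow> 'a \<Rightarrow> real" where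
  "laplacian \<Omega> f x = (\<Sum>i\<in>Basis. weak_partial \<Omega> i (weak_partial \<Omega> i f) x)"

definition H1_space :: "'a::euclidean_space set \<Rightarrow> ('a \<Rightarrow> real) set" where
  "H1_space \<Omega> = {f \<in> L_space 2 \<Omega>. \<forall>i\<in>Basis. \<exists>g\<in>L_space 2 \<Omega>. has_weak_partial \<Omega> i f g}"

definition H1_norm :: "'a::euclidean_space set \<Rightarrow> ('a \<Rightarrow> real) \<Rightarrow> real" where
  "H1_norm \<Omega> f =
     sqrt ((L_norm 2 \<Omega> f)\<^sup>2 + (\<Sum>i\<in>Basis. (L_norm 2 \<Omega> (weak_partial \<Omega> i f))\<^sup>2))"

definition H10_space :: "'a::euclidean_space set \<Rightarrow> ('a \<Rightarrow> real) set" where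
  "H10_space \<Omega> = closure_wrt (H1_space \<Omega>) (H1_norm \<Omega>) (test_functions \<Omega>)"

definition H2_space :: "'a::euclidean_space set \<Rightarrow> ('a \<Rightarrow> real) set" where
  "H2_space \<Omega> = {f \<in> H1_space \<Omega>. \<forall>i\<in>Basis. weak_partial \<Omega> i f \<in> H1_space \<Omega>}"

definition H2_norm :: "'a::euclidean_space set \<Rightarrow> ('a \<Rightarrow> real) \<Rightarrow> real" where
  "H2_norm \<Omega> f =
     sqrt ((L_norm 2 \<Omega> f)\<^sup>2 + (\<Sum>i\<in>Basis. (L_norm 2 \<Omega> (weak_partial \<Omega> i f))\<^sup>2)
       + (\<Sum>i\<in>Basis. \<Sum>j\<in>Basis. (L_norm 2 \<Omega> (weak_partial \<Omega> j (weak_partial \<Omega> i f)))\<^sup>2))"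

section \<open>Spaces of vector-valued functions of time\<close>

text \<open>
  Strong (Bochner) measurability on \<open>I\<close> with values in the space \<open>X\<close> normed by \<open>nrm\<close>:
  almost everywhere limit of simple functions.
\<close>

definition strongly_measurable ::
    "real set \<Rightarrow> ('a \<Rightarrow> real) set \<Rightarrow> (('a \<Rightarrow> real) \<Rightarrow> real) \<Rightarrow> (real \<Rightarrow> 'a \<Rightarrow> real) \<Rightarrow> bool" where
  "strongly_measurable I X nrm f \<longleftrightarrow>
     (\<exists>s. (\<forall>n. simple_function (lebesgue_on I) (s n) \<and> s n ` I \<subseteq> X) \<and>
        (AE t in lebesgue_on I. f t \<in> X \<and>
           (\<lambda>n::nat. nrm (\<lambda>x. s n t x - f t x)) \<longlonglongrightarrow> 0))"

definition Bochner_L ::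
    "real \<Rightarrow> real set \<Rightarrow> ('a \<Rightarrow> real) set \<Rightarrow> (('a \<Rightarrow> real) \<Rightarrow> real) \<Rightarrow> (real \<Rightarrow> 'a \<Rightarrow> real) set" where
  "Bochner_L q I X nrm = {f. strongly_measurable I X nrm f \<and>
     integrable (lebesgue_on I) (\<lambda>t. nrm (f t) powr q)}"

definition Bochner_Linf ::
    "real set \<Rightarrow> ('a \<Rightarrow> real) set \<Rightarrow> (('a \<Rightarrow> real) \<Rightarrow> real) \<Rightarrow> (real \<Rightarrow> 'a \<Rightarrow> real) set" where
  "Bochner_Linf I X nrm = {f. strongly_measurable I X nrm f \<and>
     (\<exists>C. AE t in lebesgue_on I. nrm (f t) \<le> C)}"

definition continuous_into ::
    "real set \<Rightarrow> ('a \<Rightarrow> real) set \<Rightarrow> (('a \<Rightarrow> real) \<Rightarrow> real) \<Rightarrow> (real \<Rightarrow> 'a \<Rightarrow> real) set" where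
  "continuous_into I X nrm = {f. \<forall>t\<in>I. f t \<in> X \<and>
     ((\<lambda>s. nrm (\<lambda>x. f s x - f t x)) \<longlongrightarrow> 0) (at t within I)}"

text \<open>
  For \<open>f\<close>, \<open>v\<close> in \<open>L\<^sup>2(I; L\<^sup>2(\<Omega>))\<close>: the identity \<open>\<integral> \<phi>' f dt = - \<integral> \<phi> v dt\<close> of Bochner integrals
  in \<open>L\<^sup>2(\<Omega>)\<close>, which is expressed by taking the inner product with every \<open>g \<in> L\<^sup>2(\<Omega>)\<close>.
\<close>

definition has_weak_time_deriv ::
    "'a::euclidean_space set \<Rightarrow> real set \<Rightarrow> (real \<Rightarrow> 'a \<Rightarrow> real) \<Rightarrow> (real \<Rightarrow> 'a \<Rightarrow> real) \<Rightarrow> bool" where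
  "has_weak_time_deriv \<Omega> I f v \<longleftrightarrow>
     (\<forall>\<phi>\<in>test_functions I. \<forall>g\<in>L_space 2 \<Omega>.
        (LINT t|lebesgue_on I. deriv \<phi> t * (LINT x|lebesgue_on \<Omega>. f t x * g x))
        = - (LINT t|lebesgue_on I. \<phi> t * (LINT x|lebesgue_on \<Omega>. v t x * g x)))"

definition W12_L2 :: "real set \<Rightarrow> 'a::euclidean_space set \<Rightarrow> (real \<Rightarrow> 'a \<Rightarrow> real) set" where
  "W12_L2 I \<Omega> = {f \<in> Bochner_L 2 I (L_space 2 \<Omega>) (L_norm 2 \<Omega>).
     \<exists>v\<in>Bochner_L 2 I (L_space 2 \<Omega>) (L_norm 2 \<Omega>). has_weak_time_deriv \<Omega> I f v}"

section \<open>The two problems\<close>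

definition neg_part :: "real \<Rightarrow> real" where "neg_part s = max (- s) 0"

text \<open>Subdifferential of the indicator function of \<open>[a, \<infinity>)\<close>.\<close>

definition subdiff_I :: "real \<Rightarrow> real \<Rightarrow> real set" where
  "subdiff_I a s = (if s > a then {0} else if s = a then {..0} else {})"

definition D_set :: "'a::euclidean_space set \<Rightarrow> real \<Rightarrow> real \<Rightarrow> ('a \<Rightarrow> real) set" where
  "D_set \<Omega> \<kappa> r = {v \<in> H2_space \<Omega> \<inter> H10_space \<Omega> \<inter> L_space 6 \<Omega>.
     (L_norm 2 \<Omega> (\<lambda>x. neg_part (laplacian \<Omega> v x - v x ^ 3 + \<kappa> * v x)))\<^sup>2 \<le> r}"

text \<open>
  A function of space and time is written \<open>u t x\<close>, so that \<open>u t\<close> is the state at time \<open>t\<close>, while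
  space-time points are pairs \<open>(x, t)\<close>.  A curve of \<open>L\<^sup>2\<close> functions is always represented by a
  function that is jointly measurable in \<open>(x, t)\<close>; this makes ``almost everywhere in
  \<open>\<Omega> \<times> (0,\<infinity>)\<close>'' independent of the representative.
\<close>

abbreviation cylinder :: "'a::euclidean_space set \<Rightarrow> ('a \<times> real) set" where
  "cylinder \<Omega> \<equiv> \<Omega> \<times> {0<..}"

definition jointly_measurable :: "'a::euclidean_space set \<Rightarrow> (real \<Rightarrow> 'a \<Rightarrow> real) \<Rightarrow> bool" where
  "jointly_measurable \<Omega> f \<longleftrightarrow> (\<lambda>(x, t). f t x) \<in> borel_measurable (lebesgue_on (cylinder \<Omega>))"

definition regular :: "'a::euclidean_space set \<Rightarrow> (real \<Rightarrow> 'a \<Rightarrow> real) \<Rightarrow> bool" where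
  "regular \<Omega> u \<longleftrightarrow> (\<forall>\<delta> T. 0 < \<delta> \<and> \<delta> < T \<longrightarrow>
     u \<in> W12_L2 {\<delta><..<T} \<Omega> \<and>
     u \<in> continuous_into {\<delta>..T} (H10_space \<Omega> \<inter> L_space 4 \<Omega>) (\<lambda>f. H1_norm \<Omega> f + L_norm 4 \<Omega> f) \<and>
     u \<in> Bochner_L 2 {\<delta><..<T} (H2_space \<Omega>) (H2_norm \<Omega>) \<and>
     u \<in> Bochner_L 6 {\<delta><..<T} (L_space 6 \<Omega>) (L_norm 6 \<Omega>))"

definition is_time_deriv ::
    "'a::euclidean_space set \<Rightarrow> (real \<Rightarrow> 'a \<Rightarrow> real) \<Rightarrow> (real \<Rightarrow> 'a \<Rightarrow> real) \<Rightarrow> bool" where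
  "is_time_deriv \<Omega> u ut \<longleftrightarrow> jointly_measurable \<Omega> ut \<and> (\<forall>\<delta> T. 0 < \<delta> \<and> \<delta> < T \<longrightarrow>
     ut \<in> Bochner_L 2 {\<delta><..<T} (L_space 2 \<Omega>) (L_norm 2 \<Omega>) \<and>
     has_weak_time_deriv \<Omega> {\<delta><..<T} u ut)"

text \<open>
  \<open>laplacian \<Omega> (u t)\<close> is chosen separately for every \<open>t\<close> and need not be jointly measurable,
  hence the jointly measurable representative \<open>Lu\<close>.
\<close>

definition is_laplacian ::
    "'a::euclidean_space set \<Rightarrow> (real \<Rightarrow> 'a \<Rightarrow> real) \<Rightarrow> (real \<Rightarrow> 'a \<Rightarrow> real) \<Rightarrow> bool" where
  "is_laplacian \<Omega> u Lu \<longleftrightarrow> jointly_measurable \<Omega> Lu \<and>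
     (AE t in lebesgue_on {0<..}. AE x in lebesgue_on \<Omega>. Lu t x = laplacian \<Omega> (u t) x)"

text \<open>The conditions common to both problems; \<open>ut\<close> and \<open>Lu\<close> stand for \<open>u\<^sub>t\<close> and \<open>\<Delta>u\<close>.\<close>

definition solution_data where
  "solution_data \<Omega> \<kappa> u0 u ut Lu \<eta> \<longleftrightarrow>
     jointly_measurable \<Omega> u \<and>
     u \<in> continuous_into {0..} (L_space 2 \<Omega>) (L_norm 2 \<Omega>) \<and>
     regular \<Omega> u \<and>
     (AE x in lebesgue_on \<Omega>. u 0 x = u0 x) \<and>
     is_time_deriv \<Omega> u ut \<and>
     is_laplacian \<Omega> u Lu \<and>
     jointly_measurable \<Omega> \<eta> \<and>
     \<eta> \<in> Bochner_Linf {0<..} (L_space 2 \<Omega>) (L_norm 2 \<Omega>) \<and>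
     (AE (x, t) in lebesgue_on (cylinder \<Omega>).
        ut t x + \<eta> t x - Lu t x + u t x ^ 3 - \<kappa> * u t x = 0)"

text \<open>\<open>u\<^sub>t = (\<Delta>u - u\<^sup>3 + \<kappa>u)\<^sub>+\<close>\<close>

definition solves_P ::
    "'a::euclidean_space set \<Rightarrow> real \<Rightarrow> ('a \<Rightarrow> real) \<Rightarrow> (real \<Rightarrow> 'a \<Rightarrow> real) \<Rightarrow> bool" where
  "solves_P \<Omega> \<kappa> u0 u \<longleftrightarrow> (\<exists>ut Lu \<eta>. solution_data \<Omega> \<kappa> u0 u ut Lu \<eta> \<and>
     (AE (x, t) in lebesgue_on (cylinder \<Omega>). \<eta> t x \<in> subdiff_I 0 (ut t x)) \<and>
     (AE (x, t) in lebesgue_on (cylinder \<Omega>).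
        \<eta> t x = - neg_part (Lu t x - u t x ^ 3 + \<kappa> * u t x)))"

text \<open>\<open>u\<^sub>t + \<partial>I\<^bsub>[u\<^sub>0(x),\<infinity>)\<^esub>(u) - \<Delta>u + u\<^sup>3 - \<kappa>u \<ni> 0\<close>\<close>

definition solves_OP ::
    "'a::euclidean_space set \<Rightarrow> real \<Rightarrow> ('a \<Rightarrow> real) \<Rightarrow> (real \<Rightarrow> 'a \<Rightarrow> real) \<Rightarrow> bool" where
  "solves_OP \<Omega> \<kappa> u0 u \<longleftrightarrow> (\<exists>ut Lu \<eta>. solution_data \<Omega> \<kappa> u0 u ut Lu \<eta> \<and>
     (AE (x, t) in lebesgue_on (cylinder \<Omega>). \<eta> t x \<in> subdiff_I (u0 x) (u t x)))"

end

theory Submission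
  imports Defs
begin

text \<open>
  The lower bound is part of the obstacle condition: \<open>\<partial>I\<close> has nonempty values only on \<open>[u\<^sub>0, \<infinity>)\<close>.

  The upper bound is a maximum principle.  Let \<open>M = max (\<surd>\<kappa>) \<parallel>u\<^sub>0\<parallel>\<^sub>\<infinity>\<close>.  Where \<open>u > M\<close> the solution lies
  strictly above the obstacle, so \<open>\<eta> = 0\<close>, and \<open>u\<^sup>3 - \<kappa>u \<ge> 0\<close> because \<open>u \<ge> \<surd>\<kappa>\<close>; hence \<open>u\<^sub>t \<le> \<Delta>u\<close> there.
  Multiply by \<open>G(u)\<close>, where \<open>G\<close> is nondecreasing, vanishes up to \<open>M\<close> and is positive beyond it.  Since
  \<open>\<integral> \<Delta>u G(u) \<le> 0\<close>, the energy \<open>\<integral> H(u)\<close> with \<open>H' = G\<close> does not increase; it starts at zero, so it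
  stays zero, which means \<open>u \<le> M\<close>.

  Usually \<open>G\<close> is the positive part of \<open>s - M\<close>.  Here \<open>G\<close> is a smooth function with the same sign
  behaviour (\<open>cutoff\<close>), built from \<open>exp (- 1 / s)\<close>.  Since \<open>0 \<le> M\<close>, it turns test functions into test
  functions, and this removes the need for chain rules in Sobolev and Bochner spaces:

  \<^item> In space, \<open>u\<close> is approximated in \<open>H\<^sup>1\<close> by a test function \<open>\<phi>\<close>, the Laplacian is tested with \<open>G(\<phi>)\<close>,
    and the classical chain rule for \<open>G(\<phi>)\<close> yields an upper bound that tends to zero
    (\<open>integral_laplacian_cutoff_nonpos\<close>).

  \<^item> In time, convexity of \<open>H\<close> bounds an increment of the energy by the increment of \<open>u\<close> tested with
    the fixed function \<open>G(u(t))\<close>.  That is an integral of \<open>u\<^sub>t\<close> by the fundamental theorem of calculus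
    for weak derivatives (\<open>weak_derivative_increment\<close>), and continuity of \<open>u\<close> in \<open>L\<^sup>2\<close> allows \<open>G(u(t))\<close> to
    be replaced by \<open>G(u(\<tau>))\<close> on short time intervals (\<open>energy_increment\<close>).

  Two supporting facts have their own sections.  Weak derivatives are unique almost everywhere, so
  that the arbitrary representatives entering \<open>laplacian\<close> and \<open>H1_norm\<close> are square integrable whenever
  some representative is.  Null sets of the cylinder correspond to families of null time slices,
  which links the equation, given almost everywhere in space-time, with the energy argument, which
  works at fixed times.
\<close>

section \<open>Smooth functions\<close>

lemma partial_deriv_eqI:
  "(f has_derivative D) (at x) \<Longrightarrow> partial_deriv i f x = D i"
  unfolding partial_deriv_def by (simp add: frechet_derivative_at[symmetric])

lemma partial_deriv_real_eqI:
  fixes f :: "real \<Rightarrow> real"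
  assumes "(f has_real_derivative D) (at x)" and "i \<in> Basis"
  shows "partial_deriv i f x = D"
  using partial_deriv_eqI[OF assms(1)[unfolded has_field_derivative_def]] assms(2) by simp

lemma smooth_on_imp_differentiable:
  assumes "smooth_on UNIV f" shows "f differentiable (at x)"
proof -
  have "C_k_on (Suc 0) UNIV f" using assms unfolding smooth_on_def by blast
  then show ?thesis by simp
qed

lemma smooth_on_imp_continuous:
  "smooth_on UNIV f \<Longrightarrow> continuous_on S f"
  by (intro continuous_at_imp_continuous_on ballI differentiable_imp_continuous_within
      smooth_on_imp_differentiable)

lemma smooth_on_partial_deriv:
  assumes "smooth_on UNIV f" "i \<in> Basis" shows "smooth_on UNIV (partial_deriv i f)"
  unfolding smooth_on_def
proof
  fix k
  have "C_k_on (Suc k) UNIV f" using assms unfolding smooth_on_def by blast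
  then show "C_k_on k UNIV (partial_deriv i f)" using assms(2) by simp
qed

lemma has_derivative_partial_deriv:
  fixes f :: "'a::euclidean_space \<Rightarrow> real"
  assumes "f differentiable (at x)"
  shows "(f has_derivative (\<lambda>h. frechet_derivative f (at x) h)) (at x)"
  using assms frechet_derivative_works by blast

lemma C_k_on_Suc_D:
  "C_k_on (Suc k) UNIV f \<Longrightarrow> C_k_on k UNIV f"
proof (induction k arbitrary: f)
  case 0
  then show ?case
    by (auto intro!: continuous_at_imp_continuous_on differentiable_imp_continuous_within)
next
  case (Suc k)
  from Suc.prems have "f differentiable (at x)" for x
    by (simp only: C_k_on.simps) blast
  moreover have "C_k_on k UNIV (partial_deriv i f)" if "i \<in> Basis" for i
    using Suc.prems that by (intro Suc.IH) simp
  ultimately show ?case by simp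
qed

lemma partial_deriv_add:
  assumes "f differentiable (at x)" "g differentiable (at x)"
  shows "partial_deriv i (\<lambda>x. f x + g x) x = partial_deriv i f x + partial_deriv i g x"
  unfolding partial_deriv_def[of i f] partial_deriv_def[of i g]
  by (rule partial_deriv_eqI[OF has_derivative_add[OF has_derivative_partial_deriv[OF assms(1)]
          has_derivative_partial_deriv[OF assms(2)]]])

lemma partial_deriv_mult:
  assumes "f differentiable (at x)" "g differentiable (at x)"
  shows "partial_deriv i (\<lambda>x. f x * g x) x = f x * partial_deriv i g x + partial_deriv i f x * g x"
  unfolding partial_deriv_def[of i f] partial_deriv_def[of i g]
  by (rule partial_deriv_eqI[OF has_derivative_mult[OF has_derivative_partial_deriv[OF assms(1)]
          has_derivative_partial_deriv[OF assms(2)]]])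

lemma partial_deriv_compose:
  fixes g :: "real \<Rightarrow> real"
  assumes "g differentiable (at (f x))" "f differentiable (at x)"
  shows "partial_deriv i (\<lambda>x. g (f x)) x = partial_deriv 1 g (f x) * partial_deriv i f x"
proof -
  let ?D = "frechet_derivative g (at (f x))"
  have D: "(g has_derivative ?D) (at (f x))"
    using assms(1) by (rule has_derivative_partial_deriv)
  have "?D h = h * ?D 1" for h
    using linear_cmul[OF has_derivative_linear[OF D], of h 1] by simp
  then have "partial_deriv i (\<lambda>x. g (f x)) x = frechet_derivative f (at x) i * ?D 1"
    using partial_deriv_eqI[OF has_derivative_compose[OF has_derivative_partial_deriv[OF assms(2)] D]]
    by metis
  then show ?thesis
    by (simp add: partial_deriv_def mult.commute)
qed

lemma C_k_on_add:
  "C_k_on k UNIV f \<Longrightarrow> C_k_on k UNIV g \<Longrightarrow> C_k_on k UNIV (\<lambda>x. f x + g x)"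
proof (induction k arbitrary: f g)
  case 0
  then show ?case by (simp add: continuous_on_add)
next
  case (Suc k)
  have "partial_deriv i (\<lambda>x. f x + g x) = (\<lambda>x. partial_deriv i f x + partial_deriv i g x)" for i
    using Suc.prems by (auto intro!: partial_deriv_add)
  then show ?case using Suc by (auto intro: differentiable_add)
qed

lemma C_k_on_mult:
  "C_k_on k UNIV f \<Longrightarrow> C_k_on k UNIV g \<Longrightarrow> C_k_on k UNIV (\<lambda>x. f x * g x)"
proof (induction k arbitrary: f g)
  case 0
  then show ?case by (simp add: continuous_on_mult)
next
  case (Suc k)
  have "partial_deriv i (\<lambda>x. f x * g x)
      = (\<lambda>x. f x * partial_deriv i g x + partial_deriv i f x * g x)" for i
    using Suc.prems by (auto intro!: partial_deriv_mult)
  moreover have "C_k_on k UNIV f" "C_k_on k UNIV g"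
    using Suc.prems by (blast intro: C_k_on_Suc_D)+
  ultimately show ?case using Suc by (auto intro!: differentiable_mult C_k_on_add)
qed

lemma C_k_on_compose:
  fixes g :: "real \<Rightarrow> real"
  shows "C_k_on k UNIV g \<Longrightarrow> C_k_on k UNIV f \<Longrightarrow> C_k_on k UNIV (\<lambda>x. g (f x))"
proof (induction k arbitrary: f g)
  case 0
  then show ?case using continuous_on_compose2[of UNIV g UNIV f] by simp
next
  case (Suc k)
  have "partial_deriv i (\<lambda>x. g (f x)) = (\<lambda>x. partial_deriv 1 g (f x) * partial_deriv i f x)" for i
    using Suc.prems by (auto intro!: partial_deriv_compose)
  moreover have "C_k_on k UNIV f"
    using Suc.prems by (blast intro: C_k_on_Suc_D)
  moreover have "(\<lambda>x. g (f x)) differentiable (at x)" for x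
    using differentiable_chain_at[of f x g] Suc.prems by (simp add: o_def)
  ultimately show ?case using Suc by (auto intro!: C_k_on_mult)
qed

lemma partial_deriv_const: "partial_deriv i (\<lambda>_. c) = (\<lambda>_. 0)"
  by (rule ext, rule partial_deriv_eqI[of _ "\<lambda>_. 0"]) simp

lemma smooth_on_const: "smooth_on UNIV (\<lambda>_::'a::euclidean_space. c)"
proof -
  have "C_k_on k UNIV (\<lambda>_::'a. c)" for k
    by (induction k arbitrary: c) (simp_all add: partial_deriv_const)
  then show ?thesis by (simp add: smooth_on_def)
qed

lemma smooth_onI:
  assumes "\<And>x. f differentiable (at x)" "\<And>i. i \<in> Basis \<Longrightarrow> smooth_on UNIV (partial_deriv i f)"
  shows "smooth_on UNIV f"
proof -
  have "C_k_on (Suc k) UNIV f" for k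
    using assms by (simp add: smooth_on_def)
  then have "C_k_on k UNIV f" for k
    by (rule C_k_on_Suc_D)
  then show ?thesis by (simp add: smooth_on_def)
qed

lemma smooth_on_inner: "smooth_on UNIV (\<lambda>x. x \<bullet> e)"
proof (rule smooth_onI)
  have D: "((\<lambda>x. x \<bullet> e) has_derivative (\<lambda>h. h \<bullet> e)) (at x)" for x
    by (rule has_derivative_inner_left[OF has_derivative_ident])
  show "(\<lambda>x. x \<bullet> e) differentiable (at x)" for x
    using D unfolding differentiable_def by blast
  have "partial_deriv i (\<lambda>x. x \<bullet> e) = (\<lambda>_. i \<bullet> e)" for i
    using partial_deriv_eqI[OF D] by auto
  then show "smooth_on UNIV (partial_deriv i (\<lambda>x. x \<bullet> e))" for i
    by (simp add: smooth_on_const)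
qed

lemma smooth_on_add:
  "smooth_on UNIV f \<Longrightarrow> smooth_on UNIV g \<Longrightarrow> smooth_on UNIV (\<lambda>x. f x + g x)"
  by (simp add: smooth_on_def C_k_on_add)

lemma smooth_on_mult:
  "smooth_on UNIV f \<Longrightarrow> smooth_on UNIV g \<Longrightarrow> smooth_on UNIV (\<lambda>x. f x * g x)"
  by (simp add: smooth_on_def C_k_on_mult)

lemma smooth_on_compose:
  "smooth_on UNIV (g :: real \<Rightarrow> real) \<Longrightarrow> smooth_on UNIV f \<Longrightarrow> smooth_on UNIV (\<lambda>x. g (f x))"
  by (simp add: smooth_on_def C_k_on_compose)

lemma smooth_on_diff:
  assumes "smooth_on UNIV f" "smooth_on UNIV g"
  shows "smooth_on UNIV (\<lambda>x. f x - g x)"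
  using smooth_on_add[OF assms(1) smooth_on_mult[OF smooth_on_const[of "-1"] assms(2)]] by simp

lemma smooth_on_prod:
  assumes "finite A" "\<And>a. a \<in> A \<Longrightarrow> smooth_on UNIV (f a)"
  shows "smooth_on UNIV (\<lambda>x. \<Prod>a\<in>A. f a x)"
  using assms by (induction A rule: finite_induct) (simp_all add: smooth_on_const smooth_on_mult)

subsection \<open>Flat functions\<close>

text \<open>The derivatives of \<open>exp (- 1 / s)\<close>, extended by zero to \<open>s \<le> 0\<close>, all have this form; this closed
  family is what makes the smoothness of the extension provable by induction.\<close>

definition flat :: "real poly \<Rightarrow> real \<Rightarrow> real" where
  "flat p s = (if s > 0 then poly p (1 / s) * exp (- (1 / s)) else 0)"

lemma poly_times_exp_minus_tendsto_0:
  "((\<lambda>y::real. poly p y * exp (- y)) \<longlongrightarrow> 0) at_top"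
proof -
  have "((\<lambda>y::real. poly p y * (y ^ k / exp y)) \<longlongrightarrow> 0) at_top" for k
  proof (induction p arbitrary: k)
    case (pCons a p)
    have "((\<lambda>y::real. a * (y ^ k / exp y) + poly p y * (y ^ Suc k / exp y)) \<longlongrightarrow> a * 0 + 0) at_top"
      by (intro tendsto_intros tendsto_power_div_exp_0 pCons.IH)
    then show ?case by (simp add: algebra_simps)
  qed simp
  from this[of 0] show ?thesis by (simp add: exp_minus field_simps)
qed

lemma flat_has_derivative:
  "(flat p has_real_derivative flat ([:0, 0, 1:] * (p - pderiv p)) s) (at s)"
proof -
  consider "s > 0" | "s < 0" | "s = 0" by linarith
  then show ?thesis
  proof cases
    case 1
    have "((\<lambda>s. poly p (1 / s) * exp (- (1 / s))) has_real_derivative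
        flat ([:0, 0, 1:] * (p - pderiv p)) s) (at s)"
      using 1 unfolding flat_def
      by (auto intro!: derivative_eq_intros simp: field_simps power2_eq_square)
    then show ?thesis
      by (rule DERIV_cong_ev[THEN iffD1, OF refl _ refl, rotated])
        (use eventually_nhds_in_open[of "{0<..}" s] 1 in
          \<open>auto simp: flat_def elim!: eventually_mono\<close>)
  next
    case 2
    have "((\<lambda>s. 0) has_real_derivative flat ([:0, 0, 1:] * (p - pderiv p)) s) (at s)"
      using 2 by (simp add: flat_def)
    then show ?thesis
      by (rule DERIV_cong_ev[THEN iffD1, OF refl _ refl, rotated])
        (use eventually_nhds_in_open[of "{..<0}" s] 2 in
          \<open>auto simp: flat_def elim!: eventually_mono\<close>)
  next
    case 3
    have "((\<lambda>h. flat p h / h) \<longlongrightarrow> 0) (at_right 0)"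
    proof -
      have "((\<lambda>h. poly (pCons 0 p) (inverse h) * exp (- inverse h)) \<longlongrightarrow> 0) (at_right (0::real))"
        by (rule filterlim_compose[OF poly_times_exp_minus_tendsto_0 filterlim_inverse_at_top_right])
      then show ?thesis
        by (rule Lim_transform_eventually)
          (auto simp: eventually_at_right_field flat_def field_simps intro!: exI[of _ 1])
    qed
    moreover have "((\<lambda>h. flat p h / h) \<longlongrightarrow> 0) (at_left 0)"
      by (rule tendsto_eventually)
        (auto simp: eventually_at_left_field flat_def intro!: exI[of _ "-1"])
    ultimately have "((\<lambda>h. flat p h / h) \<longlongrightarrow> 0) (at 0)"
      by (simp add: filterlim_at_split)
    then show ?thesis using 3 by (simp add: DERIV_def flat_def)
  qed
qed

lemma smooth_on_flat: "smooth_on UNIV (flat p)"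
proof -
  have "C_k_on k UNIV (flat p)" for k
  proof (induction k arbitrary: p)
    case 0
    show ?case by (simp add: DERIV_continuous_on[OF has_field_derivative_at_within[OF flat_has_derivative]])
  next
    case (Suc k)
    have "partial_deriv i (flat p) = flat ([:0, 0, 1:] * (p - pderiv p))" if "i \<in> Basis" for i
      using partial_deriv_real_eqI[OF flat_has_derivative that] by blast
    moreover have "flat p differentiable (at x)" for x
      using flat_has_derivative real_differentiable_def by blast
    ultimately show ?case using Suc by simp
  qed
  then show ?thesis by (simp add: smooth_on_def)
qed

section \<open>Test functions\<close>

text \<open>Any compact subset of \<open>S\<close> outside of which the function vanishes can take the place of the closed support,
  which is rarely known exactly.\<close>

lemma test_functionsI:
  assumes "smooth_on UNIV \<phi>" "compact K" "K \<subseteq> S" "\<And>x. x \<notin> K \<Longrightarrow> \<phi> x = 0"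
  shows "\<phi> \<in> test_functions S"
proof -
  have "closure {x. \<phi> x \<noteq> 0} \<subseteq> K"
    using assms(2,4) by (intro closure_minimal compact_imp_closed) auto
  then show ?thesis
    using assms(1-3) compact_Int_closed[OF assms(2) closed_closure, of "{x. \<phi> x \<noteq> 0}"]
    by (auto simp: test_functions_def Int_absorb1)
qed

lemma test_functionsE:
  assumes "\<phi> \<in> test_functions S"
  obtains K where "smooth_on UNIV \<phi>" "compact K" "K \<subseteq> S" "\<And>x. x \<notin> K \<Longrightarrow> \<phi> x = 0"
proof (rule that)
  show "\<phi> x = 0" if "x \<notin> closure {x. \<phi> x \<noteq> 0}" for x
    using that closure_subset[of "{x. \<phi> x \<noteq> 0}"] by blast
qed (use assms in \<open>auto simp: test_functions_def\<close>)

lemma test_functions_smooth: "\<phi> \<in> test_functions S \<Longrightarrow> smooth_on UNIV \<phi>"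
  by (simp add: test_functions_def)

lemma test_functions_bounded:
  assumes "\<phi> \<in> test_functions S"
  obtains B where "B \<ge> 0" "\<And>x. \<bar>\<phi> x\<bar> \<le> B"
proof -
  obtain K where K: "smooth_on UNIV \<phi>" "compact K" "\<And>x. x \<notin> K \<Longrightarrow> \<phi> x = 0"
    by (rule test_functionsE[OF assms], rule that) auto
  have "compact (\<phi> ` K)"
    by (rule compact_continuous_image[OF smooth_on_imp_continuous[OF K(1)] K(2)])
  then obtain B where B: "\<And>x. x \<in> K \<Longrightarrow> \<bar>\<phi> x\<bar> \<le> B"
    by (metis bounded_iff compact_imp_bounded imageI real_norm_def)
  then have "\<bar>\<phi> x\<bar> \<le> \<bar>B\<bar>" for x
    using K(3)[of x] B[of x] by (cases "x \<in> K") fastforce+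
  then show ?thesis by (intro that[of "\<bar>B\<bar>"]) auto
qed

lemma test_functions_borel [measurable_dest]:
  "\<phi> \<in> test_functions S \<Longrightarrow> \<phi> \<in> borel_measurable borel"
  by (intro borel_measurable_continuous_onI smooth_on_imp_continuous test_functions_smooth)

lemma test_functions_lebesgue:
  assumes "\<phi> \<in> test_functions S" shows "\<phi> \<in> borel_measurable lebesgue"
proof -
  have "\<phi> \<in> borel_measurable lborel" using test_functions_borel[OF assms] by simp
  then show ?thesis by (rule measurable_completion)
qed

lemma partial_deriv_test_functions:
  assumes "\<phi> \<in> test_functions S" "i \<in> Basis"
  shows "partial_deriv i \<phi> \<in> test_functions S"
proof -
  obtain K where K: "smooth_on UNIV \<phi>" "compact K" "K \<subseteq> S" "\<And>x. x \<notin> K \<Longrightarrow> \<phi> x = 0"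
    by (rule test_functionsE[OF assms(1)], rule that) auto
  show ?thesis
  proof (rule test_functionsI[OF smooth_on_partial_deriv[OF K(1) assms(2)] K(2,3)])
    fix x assume "x \<notin> K"
    then have "eventually (\<lambda>y. y \<in> - K) (nhds x)"
      using K(2) by (intro eventually_nhds_in_open) (auto simp: compact_imp_closed open_Compl)
    then have "eventually (\<lambda>y. \<phi> y = 0) (nhds x)"
      by (rule eventually_mono) (simp add: K(4))
    then obtain U where U: "open U" "x \<in> U" "\<And>y. y \<in> U \<Longrightarrow> \<phi> y = 0"
      by (auto simp: eventually_nhds)
    have "(\<phi> has_derivative (\<lambda>_. 0)) (at x)"
      by (rule has_derivative_transform_within_open[OF has_derivative_const U(1,2)])
        (simp add: U(3))
    then show "partial_deriv i \<phi> x = 0" by (rule partial_deriv_eqI)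
  qed
qed

lemma test_functions_mult:
  assumes "\<phi> \<in> test_functions S" "smooth_on UNIV \<psi>"
  shows "(\<lambda>x. \<phi> x * \<psi> x) \<in> test_functions S"
proof -
  obtain K where K: "smooth_on UNIV \<phi>" "compact K" "K \<subseteq> S" "\<And>x. x \<notin> K \<Longrightarrow> \<phi> x = 0"
    by (rule test_functionsE[OF assms(1)], rule that) auto
  show ?thesis
    by (rule test_functionsI[OF smooth_on_mult[OF K(1) assms(2)] K(2,3)]) (simp add: K(4))
qed

lemma locally_integrable_times_test:
  assumes f: "locally_integrable S f" and \<phi>: "\<phi> \<in> test_functions S" and S: "S \<in> sets lebesgue"
  shows "integrable lebesgue (\<lambda>x. f x * \<phi> x)"
    and "integrable (lebesgue_on S) (\<lambda>x. f x * \<phi> x)"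
    and "(LINT x|lebesgue_on S. f x * \<phi> x) = (LINT x|lebesgue. f x * \<phi> x)"
proof -
  obtain K where K: "compact K" "K \<subseteq> S" "\<And>x. x \<notin> K \<Longrightarrow> \<phi> x = 0"
    by (rule test_functionsE[OF \<phi>], rule that) auto
  obtain B where B: "B \<ge> 0" "\<And>x. \<bar>\<phi> x\<bar> \<le> B"
    using test_functions_bounded[OF \<phi>] by blast
  have \<phi>m [measurable]: "\<phi> \<in> borel_measurable lebesgue"
    using \<phi> by (rule test_functions_lebesgue)
  have int: "integrable lebesgue (\<lambda>x. indicator K x *\<^sub>R f x)"
    using f K(1,2) by (simp add: locally_integrable_def set_integrable_def)
  have "integrable lebesgue (\<lambda>x. indicator K x *\<^sub>R f x * \<phi> x)"
  proof (rule Bochner_Integration.integrable_bound[OF integrable_mult_right[OF int, of B]])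
    show "(\<lambda>x. indicator K x *\<^sub>R f x * \<phi> x) \<in> borel_measurable lebesgue"
      using borel_measurable_times[OF borel_measurable_integrable[OF int] \<phi>m] by simp
    show "AE x in lebesgue. norm (indicator K x *\<^sub>R f x * \<phi> x) \<le> norm (B * indicator K x *\<^sub>R f x)"
      using B by (intro AE_I2) (auto simp: abs_mult indicator_def mult.commute intro: mult_right_mono)
  qed
  moreover have eq: "indicator K x *\<^sub>R f x * \<phi> x = f x * \<phi> x" for x
    using K(3)[of x] by (cases "x \<in> K") auto
  ultimately show *: "integrable lebesgue (\<lambda>x. f x * \<phi> x)" by (simp only: eq)
  have eq2: "indicator S x *\<^sub>R (f x * \<phi> x) = f x * \<phi> x" for x
    using K(2) K(3)[of x] by (cases "x \<in> S") auto
  have S': "S \<inter> space lebesgue \<in> sets lebesgue" using S by simp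
  show "integrable (lebesgue_on S) (\<lambda>x. f x * \<phi> x)"
    unfolding integrable_restrict_space[OF S'] eq2 by (rule *)
  show "(LINT x|lebesgue_on S. f x * \<phi> x) = (LINT x|lebesgue. f x * \<phi> x)"
    unfolding integral_restrict_space[OF S'] eq2 ..
qed

section \<open>Uniqueness of weak derivatives\<close>

text \<open>The sets on which a Borel representative of \<open>h\<close> integrates to zero include the boxes and are closed
  under complements and disjoint countable unions, so they are all Borel sets.\<close>

lemma integral_zero_on_boxes_imp_zero:
  fixes h :: "'a::euclidean_space \<Rightarrow> real"
  assumes h: "integrable lebesgue h"
    and box: "\<And>a b. (LINT x:box a b|lebesgue. h x) = 0" and UNIV: "(LINT x|lebesgue. h x) = 0"
  shows "AE x in lebesgue. h x = 0"
proof -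
  obtain g where g [measurable]: "g \<in> borel_measurable lborel" and hg: "AE x in lborel. h x = g x"
    using completion_ex_borel_measurable_real[OF borel_measurable_integrable[OF h]] by blast
  have hg': "AE x in lebesgue. h x = g x"
    using hg by (rule AE_completion)
  have "integrable lebesgue g"
    by (rule integrable_cong_AE_imp[OF h]) (use hg' g in \<open>auto intro: measurable_completion elim: eventually_mono\<close>)
  then have int: "integrable lborel g"
    by (simp add: integrable_completion)
  have eq: "(LINT x:A|lborel. g x) = (LINT x:A|lebesgue. h x)" if A: "A \<in> sets borel" for A
  proof -
    have "(LINT x:A|lborel. g x) = (LINT x|lebesgue. indicator A x *\<^sub>R g x)"
      unfolding set_lebesgue_integral_def using A by (intro integral_completion[symmetric]) simp
    also have "\<dots> = (LINT x|lebesgue. indicator A x *\<^sub>R h x)"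
    proof (rule integral_cong_AE)
      show "(\<lambda>x. indicator A x *\<^sub>R g x) \<in> borel_measurable lebesgue"
        using A by (intro measurable_completion) simp
      show "(\<lambda>x. indicator A x *\<^sub>R h x) \<in> borel_measurable lebesgue"
        using A h by (intro borel_measurable_scaleR borel_measurable_indicator
            borel_measurable_integrable[OF h]) auto
    qed (use hg' in auto)
    finally show ?thesis unfolding set_lebesgue_integral_def .
  qed
  have tot: "(LINT x|lborel. g x) = 0"
    using eq[of UNIV] UNIV by (simp add: set_lebesgue_integral_def)
  have zero: "(LINT x:A|lborel. g x) = 0" if "A \<in> sets borel" for A
  proof -
    have "Int_stable (range (\<lambda>(a, b). box a b::'a set))"
      by (auto simp: Int_stable_def box_Int_box)
    moreover have "range (\<lambda>(a, b). box a b::'a set) \<subseteq> Pow UNIV" by simp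
    moreover have "A \<in> sigma_sets UNIV (range (\<lambda>(a, b). box a b::'a set))"
      using that by (simp add: borel_eq_box)
    ultimately show ?thesis
    proof (induction rule: sigma_sets_induct_disjoint[consumes 3])
      case (basic A)
      then show ?case using eq box by auto
    next
      case (compl A)
      then have A: "A \<in> sets borel" by (simp add: borel_eq_box)
      have "(LINT x:UNIV - A|lborel. g x) = (LINT x|lborel. g x) - (LINT x:A|lborel. g x)"
      proof -
        have i: "integrable lborel (\<lambda>x. indicator A x *\<^sub>R g x)"
          using A int by (intro integrable_mult_indicator) auto
        have "(LINT x|lborel. g x) - (LINT x|lborel. indicator A x *\<^sub>R g x)
            = (LINT x|lborel. g x - indicator A x *\<^sub>R g x)"
          using i int by simp
        also have "\<dots> = (LINT x|lborel. indicator (UNIV - A) x *\<^sub>R g x)"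
          by (intro Bochner_Integration.integral_cong) (auto simp: indicator_def)
        finally show ?thesis by (simp add: set_lebesgue_integral_def)
      qed
      then show ?case using compl tot by simp
    next
      case (union A)
      then have A: "A i \<in> sets lborel" for i
        using union(2) by (auto simp: borel_eq_box)
      then have "set_integrable lborel (\<Union>i. A i) g"
        unfolding set_integrable_def by (intro integrable_mult_indicator int) auto
      then have "(LINT x:(\<Union>i. A i)|lborel. g x) = (\<Sum>i. (LINT x:(A i)|lborel. g x))"
        using A union by (intro lebesgue_integral_countable_add) (auto simp: disjoint_family_on_def)
      then show ?case using union by simp
    qed (auto simp: set_lebesgue_integral_def)
  qed
  have "AE x in lborel. g x = 0"
    by (rule density_unique_real[OF int]) (use zero in \<open>simp_all add: set_lebesgue_integral_def\<close>)
  then have "AE x in lebesgue. g x = 0" by (rule AE_completion)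
  then show ?thesis using hg' by eventually_elim simp
qed

text \<open>A product of flat functions of the distances to the faces is positive in the open box only;
  after rescaling, it increases to one there.\<close>

definition box_bump :: "'a::euclidean_space \<Rightarrow> 'a \<Rightarrow> nat \<Rightarrow> 'a \<Rightarrow> real" where
  "box_bump a b n x =
     (\<Prod>i\<in>Basis. flat 1 (real n * (x \<bullet> i - a \<bullet> i)) * flat 1 (real n * (b \<bullet> i - x \<bullet> i)))"

lemma flat_1_bounds: "0 \<le> flat 1 s" "flat 1 s \<le> 1"
  by (auto simp: flat_def)

lemma flat_1_rescaled: "0 < s \<Longrightarrow> (\<lambda>n. flat 1 (real n * s)) \<longlonglongrightarrow> 1"
proof -
  assume s: "0 < s"
  have "(\<lambda>n. exp (- (1 / s) * inverse (real n))) \<longlonglongrightarrow> exp (- (1 / s) * 0)"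
    by (intro tendsto_intros lim_inverse_n)
  then have "(\<lambda>n. exp (- (1 / s) * inverse (real n))) \<longlonglongrightarrow> 1" by simp
  moreover have "exp (- (1 / s) * inverse (real n)) = flat 1 (real n * s)" if "n \<ge> 1" for n
  proof -
    have "0 < real n * s" using s that by simp
    then show ?thesis by (simp add: flat_def inverse_eq_divide mult.commute)
  qed
  then have "\<forall>\<^sub>F n in sequentially. exp (- (1 / s) * inverse (real n)) = flat 1 (real n * s)"
    by (rule eventually_sequentiallyI)
  ultimately show ?thesis by (rule Lim_transform_eventually)
qed

lemma box_bump_bounds: "0 \<le> box_bump a b n x" "box_bump a b n x \<le> 1"
  unfolding box_bump_def
  by (intro prod_nonneg mult_nonneg_nonneg flat_1_bounds ballI,
      intro prod_le_1 conjI mult_nonneg_nonneg mult_le_one flat_1_bounds)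

lemma box_bump_outside:
  assumes "x \<notin> box a b"
  shows "box_bump a b n x = 0"
proof -
  obtain i where "i \<in> Basis" "x \<bullet> i \<le> a \<bullet> i \<or> b \<bullet> i \<le> x \<bullet> i"
    using assms by (auto simp: mem_box not_less)
  then have "flat 1 (real n * (x \<bullet> i - a \<bullet> i)) * flat 1 (real n * (b \<bullet> i - x \<bullet> i)) = 0"
    by (auto simp: flat_def mult_le_0_iff zero_less_mult_iff)
  then show ?thesis
    unfolding box_bump_def using \<open>i \<in> Basis\<close> by (intro prod_zero) auto
qed

lemma box_bump_tendsto:
  fixes a b :: "'a::euclidean_space"
  shows "(\<lambda>n. box_bump a b n x) \<longlonglongrightarrow> indicator (box a b) x"
proof (cases "x \<in> box a b")
  case True
  then have "(\<lambda>n. box_bump a b n x) \<longlonglongrightarrow> (\<Prod>i\<in>(Basis :: 'a set). 1 * 1)"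
    unfolding box_bump_def
    by (intro tendsto_prod tendsto_mult flat_1_rescaled) (auto simp: mem_box)
  then show ?thesis using True by simp
qed (simp add: box_bump_outside)

lemma box_bump_smooth: "smooth_on UNIV (box_bump a b n)"
  unfolding box_bump_def[abs_def]
  by (intro smooth_on_prod smooth_on_mult smooth_on_compose[OF smooth_on_flat] smooth_on_const
      smooth_on_diff smooth_on_inner) simp

lemma box_bump_test:
  assumes "cbox a b \<subseteq> S"
  shows "box_bump a b n \<in> test_functions S"
proof (rule test_functionsI[OF box_bump_smooth compact_cbox assms])
  show "box_bump a b n x = 0" if "x \<notin> cbox a b" for x
    using that box_subset_cbox[of a b] by (intro box_bump_outside) blast
qed

text \<open>The fundamental lemma of the calculus of variations: indicators of boxes are bounded limits of
  test functions, and boxes generate the Borel sets.\<close>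

lemma fundamental_lemma_calculus_of_variations:
  fixes h :: "'a::euclidean_space \<Rightarrow> real"
  assumes S: "open S" and h: "locally_integrable S h"
    and zero: "\<And>\<phi>. \<phi> \<in> test_functions S \<Longrightarrow> (LINT x|lebesgue_on S. h x * \<phi> x) = 0"
  shows "AE x in lebesgue_on S. h x = 0"
proof -
  have Sl: "S \<in> sets lebesgue" using S by auto
  have int: "integrable lebesgue (\<lambda>x. indicator K x *\<^sub>R h x)" if "compact K" "K \<subseteq> S" for K
    using h that by (simp add: locally_integrable_def set_integrable_def)
  have box0: "(LINT x:box a b|lebesgue. h x) = 0" if ab: "cbox a b \<subseteq> S" for a b
  proof -
    have m: "box_bump a b n \<in> borel_measurable lebesgue" for n
      using box_bump_test[OF ab] by (rule test_functions_lebesgue)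
    have hm: "(\<lambda>x. indicator (cbox a b) x *\<^sub>R h x) \<in> borel_measurable lebesgue"
      using int[OF compact_cbox ab] by (rule borel_measurable_integrable)
    have "(\<lambda>n. LINT x|lebesgue. indicator (cbox a b) x *\<^sub>R h x * box_bump a b n x)
        \<longlonglongrightarrow> (LINT x|lebesgue. indicator (cbox a b) x *\<^sub>R h x * indicator (box a b) x)"
    proof (rule integral_dominated_convergence)
      show "integrable lebesgue (\<lambda>x. norm (indicator (cbox a b) x *\<^sub>R h x))"
        using int[OF compact_cbox ab] by (rule integrable_norm)
      show "AE x in lebesgue. norm (indicator (cbox a b) x *\<^sub>R h x * box_bump a b n x)
          \<le> norm (indicator (cbox a b) x *\<^sub>R h x)" for n
        using box_bump_bounds[of a b n]
        by (intro AE_I2) (simp add: abs_mult mult_left_le)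
      show "AE x in lebesgue. (\<lambda>n. indicator (cbox a b) x *\<^sub>R h x * box_bump a b n x)
          \<longlonglongrightarrow> indicator (cbox a b) x *\<^sub>R h x * indicator (box a b) x"
        by (intro AE_I2 tendsto_mult tendsto_const box_bump_tendsto)
      show "(\<lambda>x. indicator (cbox a b) x *\<^sub>R h x * indicator (box a b) x) \<in> borel_measurable lebesgue"
        by (intro borel_measurable_times hm borel_measurable_indicator) auto
      show "(\<lambda>x. indicator (cbox a b) x *\<^sub>R h x * box_bump a b n x) \<in> borel_measurable lebesgue" for n
        by (intro borel_measurable_times hm m)
    qed
    moreover have eq: "indicator (cbox a b) x *\<^sub>R h x * box_bump a b n x = h x * box_bump a b n x" for n x
      using box_bump_outside[of x a b n] box_subset_cbox[of a b] by (cases "x \<in> cbox a b") auto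
    moreover have "(LINT x|lebesgue. h x * box_bump a b n x) = 0" for n
      using zero[OF box_bump_test[OF ab]]
        locally_integrable_times_test(3)[OF h box_bump_test[OF ab] Sl] by simp
    moreover have eq': "indicator (cbox a b) x *\<^sub>R h x * indicator (box a b) x = indicator (box a b) x *\<^sub>R h x" for x
      using box_subset_cbox[of a b] by (cases "x \<in> box a b") auto
    ultimately have "(\<lambda>n. 0) \<longlonglongrightarrow> (LINT x|lebesgue. indicator (box a b) x *\<^sub>R h x)"
      by (simp only: eq eq')
    then show ?thesis
      unfolding set_lebesgue_integral_def by (simp add: LIMSEQ_const_iff)
  qed
  have local: "AE x in lebesgue. x \<in> cbox a b \<longrightarrow> h x = 0" if ab: "cbox a b \<subseteq> S" for a b
  proof -
    let ?h = "\<lambda>x. indicator (box a b) x *\<^sub>R h x"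
    have "AE x in lebesgue. ?h x = 0"
    proof (rule integral_zero_on_boxes_imp_zero)
      have "integrable lebesgue (\<lambda>x. indicator (box a b) x *\<^sub>R (indicator (cbox a b) x *\<^sub>R h x))"
        by (intro integrable_mult_indicator int[OF compact_cbox ab]) auto
      moreover have eq: "indicator (box a b) x *\<^sub>R (indicator (cbox a b) x *\<^sub>R h x) = ?h x" for x
        using box_subset_cbox[of a b] by (cases "x \<in> box a b") auto
      ultimately show "integrable lebesgue ?h" by (simp only: eq)
      show "(LINT x|lebesgue. ?h x) = 0"
        using box0[OF ab] by (simp add: set_lebesgue_integral_def)
      fix c d
      let ?l = "\<Sum>i\<in>Basis. max (a \<bullet> i) (c \<bullet> i) *\<^sub>R i" and ?u = "\<Sum>i\<in>Basis. min (b \<bullet> i) (d \<bullet> i) *\<^sub>R i"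
      have "cbox ?l ?u \<subseteq> cbox a b" by (auto simp: mem_box)
      then have "(LINT x:box ?l ?u|lebesgue. h x) = 0" using box0 ab by blast
      moreover have "box ?l ?u = box a b \<inter> box c d" by (simp add: box_Int_box)
      ultimately have "(LINT x:box a b \<inter> box c d|lebesgue. h x) = 0" by simp
      then show "(LINT x:box c d|lebesgue. ?h x) = 0"
        by (simp add: set_lebesgue_integral_def indicator_inter_arith mult_ac)
    qed
    moreover have "AE x in lebesgue. x \<notin> cbox a b - box a b"
      using negligible_frontier_interval[of a b]
      by (intro AE_not_in) (simp add: negligible_iff_null_sets)
    ultimately show ?thesis
      by eventually_elim (auto simp: indicator_def)
  qed
  obtain \<D> :: "'a set set" where \<D>: "countable \<D>" "\<D> \<subseteq> Pow S" "\<And>X. X \<in> \<D> \<Longrightarrow> \<exists>a b. X = cbox a b" "\<Union>\<D> = S"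
    by (rule open_countable_Union_open_cbox[OF S], rule that) auto
  have "AE x in lebesgue. \<forall>X\<in>\<D>. x \<in> X \<longrightarrow> h x = 0"
    using \<D>(1)
  proof (rule AE_ball_countable[THEN iffD2, OF _ ballI])
    fix X assume "X \<in> \<D>"
    then show "AE x in lebesgue. x \<in> X \<longrightarrow> h x = 0"
      using \<D>(2) \<D>(3)[of X] local by blast
  qed
  then have "AE x in lebesgue. x \<in> S \<longrightarrow> h x = 0"
    using \<D>(4) by (auto elim!: eventually_mono)
  then show ?thesis
    using Sl by (simp add: AE_restrict_space_iff)
qed

lemma locally_integrable_diff:
  "locally_integrable S f \<Longrightarrow> locally_integrable S g \<Longrightarrow> locally_integrable S (\<lambda>x. f x - g x)"
  by (simp add: locally_integrable_def set_integral_diff(1))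

lemma has_weak_partial_unique:
  assumes S: "open S" and f: "has_weak_partial S i f g" "has_weak_partial S i f g'"
  shows "AE x in lebesgue_on S. g x = g' x"
proof -
  have li: "locally_integrable S g" "locally_integrable S g'"
    using f by (auto simp: has_weak_partial_def)
  have Sl: "S \<in> sets lebesgue" using S by auto
  have "AE x in lebesgue_on S. g x - g' x = 0"
  proof (rule fundamental_lemma_calculus_of_variations[OF S locally_integrable_diff[OF li]])
    fix \<phi> assume \<phi>: "\<phi> \<in> test_functions S"
    have "(LINT x|lebesgue_on S. g x * \<phi> x) = (LINT x|lebesgue_on S. g' x * \<phi> x)"
      using f \<phi> unfolding has_weak_partial_def by force
    then show "(LINT x|lebesgue_on S. (g x - g' x) * \<phi> x) = 0"
      using locally_integrable_times_test(2)[OF li(1) \<phi> Sl]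
        locally_integrable_times_test(2)[OF li(2) \<phi> Sl]
      by (simp add: left_diff_distrib)
  qed
  then show ?thesis by simp
qed

section \<open>Integration by parts for test functions\<close>

lemma test_functions_integrable:
  assumes \<phi>: "\<phi> \<in> test_functions S"
  shows "integrable lborel \<phi>" "integrable lebesgue \<phi>"
proof -
  obtain K where K: "compact K" "\<And>x. x \<notin> K \<Longrightarrow> \<phi> x = 0"
    by (rule test_functionsE[OF \<phi>], rule that) auto
  obtain B where B: "\<And>x. \<bar>\<phi> x\<bar> \<le> B"
    using test_functions_bounded[OF \<phi>] by blast
  have "integrable lborel (\<lambda>x. B * indicator K x)"
    using K(1) by (intro integrable_mult_right integrable_real_indicator)
      (auto simp: borel_compact dest: emeasure_compact_finite)
  then show *: "integrable lborel \<phi>"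
  proof (rule Bochner_Integration.integrable_bound)
    show "\<phi> \<in> borel_measurable lborel" using test_functions_borel[OF \<phi>] by simp
    show "AE x in lborel. norm (\<phi> x) \<le> norm (B * indicator K x)"
    proof (rule AE_I2)
      show "norm (\<phi> x) \<le> norm (B * indicator K x)" for x
        using B[of x] K(2)[of x] by (cases "x \<in> K") auto
    qed
  qed
  then show "integrable lebesgue \<phi>"
    by (simp add: integrable_completion)
qed

lemma has_real_derivative_along_line:
  fixes f :: "'a::euclidean_space \<Rightarrow> real"
  assumes "f differentiable (at (x + t *\<^sub>R e))"
  shows "((\<lambda>t. f (x + t *\<^sub>R e)) has_real_derivative partial_deriv e f (x + t *\<^sub>R e)) (at t)"
proof -
  let ?D = "frechet_derivative f (at (x + t *\<^sub>R e))"
  have D: "(f has_derivative ?D) (at (x + t *\<^sub>R e))"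
    using assms by (rule has_derivative_partial_deriv)
  have "((\<lambda>t. x + t *\<^sub>R e) has_derivative (\<lambda>h. h *\<^sub>R e)) (at t)"
    by (auto intro!: derivative_eq_intros)
  from has_derivative_compose[OF this D]
  have "((\<lambda>t. f (x + t *\<^sub>R e)) has_derivative (\<lambda>h. ?D (h *\<^sub>R e))) (at t)" .
  moreover have "?D (h *\<^sub>R e) = partial_deriv e f (x + t *\<^sub>R e) * h" for h
    using linear_cmul[OF has_derivative_linear[OF D], of h e] by (simp add: partial_deriv_def)
  ultimately show ?thesis by (simp add: has_field_derivative_def)
qed

text \<open>The integral of a difference quotient vanishes by translation invariance; the quotients
  converge boundedly, on a fixed ball, to the derivative.\<close>

lemma integral_partial_deriv_test:
  fixes \<phi> :: "'a::euclidean_space \<Rightarrow> real"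
  assumes \<phi>: "\<phi> \<in> test_functions S" and i: "i \<in> Basis"
  shows "(LINT x|lebesgue. partial_deriv i \<phi> x) = 0"
proof -
  obtain K where K: "smooth_on UNIV \<phi>" "compact K" "\<And>x. x \<notin> K \<Longrightarrow> \<phi> x = 0"
    by (rule test_functionsE[OF \<phi>], rule that) auto
  obtain R where R: "\<And>x. x \<in> K \<Longrightarrow> norm x \<le> R"
    using K(2) by (meson bounded_iff compact_imp_bounded)
  have d: "partial_deriv i \<phi> \<in> test_functions S"
    using \<phi> i by (rule partial_deriv_test_functions)
  obtain C where C: "C \<ge> 0" "\<And>x. \<bar>partial_deriv i \<phi> x\<bar> \<le> C"
    using test_functions_bounded[OF d] by blast
  have D: "((\<lambda>t. \<phi> (x + t *\<^sub>R i)) has_real_derivative partial_deriv i \<phi> (x + t *\<^sub>R i)) (at t)" for x t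
    using K(1) by (intro has_real_derivative_along_line smooth_on_imp_differentiable)
  have lip: "\<bar>\<phi> (x + h *\<^sub>R i) - \<phi> x\<bar> \<le> C * h" if "h > 0" for x h
  proof -
    have "\<exists>z>0. z < h \<and> \<phi> (x + h *\<^sub>R i) - \<phi> (x + 0 *\<^sub>R i) = (h - 0) * partial_deriv i \<phi> (x + z *\<^sub>R i)"
      by (rule MVT2[where f = "\<lambda>t. \<phi> (x + t *\<^sub>R i)"]) (use that D in auto)
    then obtain z where "\<phi> (x + h *\<^sub>R i) - \<phi> (x + 0 *\<^sub>R i) = (h - 0) * partial_deriv i \<phi> (x + z *\<^sub>R i)"
      by blast
    then show ?thesis
      using C(2)[of "x + z *\<^sub>R i"] that by (simp add: abs_mult mult.commute)
  qed
  define h where "h n = inverse (real (Suc n))" for n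
  have h: "0 < h n" "h n \<le> 1" for n
    by (simp_all add: h_def inverse_eq_divide)
  define q where "q n x = (\<phi> (x + h n *\<^sub>R i) - \<phi> x) / h n" for n x
  have int: "integrable lborel \<phi>" using test_functions_integrable[OF \<phi>] by blast
  have meas [measurable]: "\<phi> \<in> borel_measurable borel" "partial_deriv i \<phi> \<in> borel_measurable borel"
    using test_functions_borel \<phi> d by blast+
  have "(\<lambda>n. LINT x|lborel. q n x) \<longlonglongrightarrow> (LINT x|lborel. partial_deriv i \<phi> x)"
  proof (rule integral_dominated_convergence)
    show "integrable lborel (\<lambda>x. C * indicator (cball 0 (R + 1)) x)"
      by (intro integrable_mult_right integrable_real_indicator)
        (auto intro: emeasure_bounded_finite[OF bounded_cball, simplified])
    show "AE x in lborel. norm (q n x) \<le> C * indicator (cball 0 (R + 1)) x" for n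
    proof (rule AE_I2)
      fix x
      show "norm (q n x) \<le> C * indicator (cball 0 (R + 1)) x"
      proof (cases "x \<in> cball 0 (R + 1)")
        case True
        then show ?thesis using lip[OF h(1), of x n] h(1)[of n] by (simp add: q_def field_simps)
      next
        case False
        then have "norm x > R + 1" by simp
        moreover have "norm (x + h n *\<^sub>R i) \<ge> norm x - norm (h n *\<^sub>R i)"
          using norm_diff_ineq by blast
        moreover have "norm (h n *\<^sub>R i) \<le> 1" using h[of n] i by simp
        ultimately have "norm (x + h n *\<^sub>R i) > R" "norm x > R" by linarith+
        then have "x + h n *\<^sub>R i \<notin> K" "x \<notin> K" using R by fastforce+
        then show ?thesis using K(3) False by (simp add: q_def)
      qed
    qed
    show "AE x in lborel. (\<lambda>n. q n x) \<longlonglongrightarrow> partial_deriv i \<phi> x"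
    proof (rule AE_I2)
      fix x
      have "((\<lambda>s. (\<phi> (x + s *\<^sub>R i) - \<phi> x) / s) \<longlongrightarrow> partial_deriv i \<phi> x) (at 0)"
        using D[of x 0] by (simp add: DERIV_def)
      moreover have "filterlim h (at 0) sequentially"
        unfolding filterlim_at h_def[abs_def]
        by (intro conjI always_eventually LIMSEQ_inverse_real_of_nat) auto
      ultimately show "(\<lambda>n. q n x) \<longlonglongrightarrow> partial_deriv i \<phi> x"
        unfolding q_def by (rule filterlim_compose)
    qed
  qed (simp_all add: q_def)
  moreover have "(LINT x|lborel. q n x) = 0" for n
  proof -
    have eq: "(LINT x|lborel. \<phi> (x + h n *\<^sub>R i)) = (LINT x|lborel. \<phi> x)"
      using integral_distr[of "(+) (h n *\<^sub>R i)" lborel borel \<phi>]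
      by (simp add: lborel_distr_plus add.commute)
    have "integrable (distr lborel borel ((+) (h n *\<^sub>R i))) \<phi>"
      using int by (simp add: lborel_distr_plus)
    then have "integrable lborel (\<lambda>x. \<phi> (x + h n *\<^sub>R i))"
      by (subst (asm) integrable_distr_eq) (simp_all add: add.commute)
    then show ?thesis using eq int by (simp add: q_def)
  qed
  ultimately have "(LINT x|lborel. partial_deriv i \<phi> x) = 0"
    by (simp add: LIMSEQ_const_iff)
  then show ?thesis
    by (simp add: integral_completion)
qed

lemma test_functions_locally_integrable:
  assumes "\<phi> \<in> test_functions S" shows "locally_integrable T \<phi>"
  unfolding locally_integrable_def set_integrable_def
  using test_functions_integrable(2)[OF assms]
  by (auto intro!: integrable_mult_indicator simp del: real_scaleR_def simp: borel_compact)

lemma has_weak_partial_test: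
  assumes \<phi>: "\<phi> \<in> test_functions S" and i: "i \<in> Basis" and S: "S \<in> sets lebesgue"
  shows "has_weak_partial S i \<phi> (partial_deriv i \<phi>)"
  unfolding has_weak_partial_def
proof (intro conjI ballI)
  have d: "partial_deriv i \<phi> \<in> test_functions S"
    using \<phi> i by (rule partial_deriv_test_functions)
  show li: "locally_integrable S \<phi>" "locally_integrable S (partial_deriv i \<phi>)"
    using \<phi> d by (auto intro: test_functions_locally_integrable)
  fix \<psi> assume \<psi>: "\<psi> \<in> test_functions S"
  have d': "partial_deriv i \<psi> \<in> test_functions S"
    using \<psi> i by (rule partial_deriv_test_functions)
  have "partial_deriv i (\<lambda>x. \<phi> x * \<psi> x) = (\<lambda>x. \<phi> x * partial_deriv i \<psi> x + partial_deriv i \<phi> x * \<psi> x)"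
    using \<phi> \<psi> by (intro ext partial_deriv_mult smooth_on_imp_differentiable test_functions_smooth)
  then have "(LINT x|lebesgue. \<phi> x * partial_deriv i \<psi> x + partial_deriv i \<phi> x * \<psi> x) = 0"
    using integral_partial_deriv_test[OF test_functions_mult[OF \<phi> test_functions_smooth[OF \<psi>]] i]
    by simp
  then have "(LINT x|lebesgue. \<phi> x * partial_deriv i \<psi> x) = - (LINT x|lebesgue. partial_deriv i \<phi> x * \<psi> x)"
    using locally_integrable_times_test(1)[OF li(1) d' S] locally_integrable_times_test(1)[OF li(2) \<psi> S]
    by simp
  then show "(LINT x|lebesgue_on S. \<phi> x * partial_deriv i \<psi> x)
      = - (LINT x|lebesgue_on S. partial_deriv i \<phi> x * \<psi> x)"
    using locally_integrable_times_test(3)[OF li(1) d' S] locally_integrable_times_test(3)[OF li(2) \<psi> S]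
    by simp
qed

lemma has_weak_partial_diff:
  assumes f: "has_weak_partial S i f f'" and g: "has_weak_partial S i g g'"
    and i: "i \<in> Basis" and S: "S \<in> sets lebesgue"
  shows "has_weak_partial S i (\<lambda>x. f x - g x) (\<lambda>x. f' x - g' x)"
  unfolding has_weak_partial_def
proof (intro conjI ballI)
  have li: "locally_integrable S f" "locally_integrable S f'" "locally_integrable S g" "locally_integrable S g'"
    using f g by (auto simp: has_weak_partial_def)
  then show "locally_integrable S (\<lambda>x. f x - g x)" "locally_integrable S (\<lambda>x. f' x - g' x)"
    by (auto intro: locally_integrable_diff)
  fix \<psi> assume \<psi>: "\<psi> \<in> test_functions S"
  have d: "partial_deriv i \<psi> \<in> test_functions S"
    using \<psi> i by (rule partial_deriv_test_functions)
  note int = li[THEN locally_integrable_times_test(2), OF \<psi> S] li[THEN locally_integrable_times_test(2), OF d S]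
  show "(LINT x|lebesgue_on S. (f x - g x) * partial_deriv i \<psi> x)
      = - (LINT x|lebesgue_on S. (f' x - g' x) * \<psi> x)"
    using f g \<psi> int by (simp add: left_diff_distrib has_weak_partial_def)
qed

section \<open>Square integrable functions\<close>

lemma L_space_2_iff:
  "f \<in> L_space 2 S \<longleftrightarrow> f \<in> borel_measurable (lebesgue_on S) \<and> integrable (lebesgue_on S) (\<lambda>x. (f x)\<^sup>2)"
  by (simp add: L_space_def)

lemma L_norm_2: "L_norm 2 S f = sqrt (LINT x|lebesgue_on S. (f x)\<^sup>2)"
  by (simp add: L_norm_def powr_half_sqrt)

lemma L_norm_2_nonneg: "0 \<le> L_norm 2 S f"
  by (simp add: L_norm_2)

lemma L_norm_2_power2: "(L_norm 2 S f)\<^sup>2 = (LINT x|lebesgue_on S. (f x)\<^sup>2)"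
  by (simp add: L_norm_2)

lemma L_space_2_mult_integrable:
  assumes "f \<in> L_space 2 S" "g \<in> L_space 2 S"
  shows "integrable (lebesgue_on S) (\<lambda>x. f x * g x)"
proof (rule Bochner_Integration.integrable_bound)
  show "integrable (lebesgue_on S) (\<lambda>x. (f x)\<^sup>2 + (g x)\<^sup>2)"
    using assms by (simp add: L_space_2_iff)
  have "\<bar>a * b\<bar> \<le> \<bar>a\<^sup>2 + b\<^sup>2\<bar>" for a b :: real
  proof -
    have "2 * (\<bar>a\<bar> * \<bar>b\<bar>) \<le> a\<^sup>2 + b\<^sup>2" using sum_squares_bound[of "\<bar>a\<bar>" "\<bar>b\<bar>"] by simp
    moreover have "0 \<le> \<bar>a\<bar> * \<bar>b\<bar>" by simp
    ultimately show ?thesis unfolding abs_mult by linarith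
  qed
  then show "AE x in lebesgue_on S. norm (f x * g x) \<le> norm ((f x)\<^sup>2 + (g x)\<^sup>2)"
    by simp
qed (use assms in \<open>auto simp: L_space_2_iff\<close>)

lemma L_space_2_add:
  assumes "f \<in> L_space 2 S" "g \<in> L_space 2 S"
  shows "(\<lambda>x. f x + g x) \<in> L_space 2 S"
  using assms L_space_2_mult_integrable[OF assms]
  by (auto simp: L_space_2_iff power2_sum mult.assoc)

lemma L_space_2_diff:
  assumes "f \<in> L_space 2 S" "g \<in> L_space 2 S"
  shows "(\<lambda>x. f x - g x) \<in> L_space 2 S"
  using assms L_space_2_mult_integrable[OF assms]
  by (auto simp: L_space_2_iff power2_diff mult.assoc)

lemma L_space_2_sum:
  assumes "finite I" "\<And>i. i \<in> I \<Longrightarrow> f i \<in> L_space 2 S"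
  shows "(\<lambda>x. \<Sum>i\<in>I. f i x) \<in> L_space 2 S"
  using assms
proof (induction I rule: finite_induct)
  case empty
  then show ?case by (simp add: L_space_2_iff)
next
  case (insert i I)
  then show ?case using L_space_2_add[of "f i" S "\<lambda>x. \<Sum>i\<in>I. f i x"] by simp
qed

lemma L_space_2_dominated:
  assumes "g \<in> L_space 2 S" "f \<in> borel_measurable (lebesgue_on S)" "\<And>x. \<bar>f x\<bar> \<le> C * \<bar>g x\<bar>"
  shows "f \<in> L_space 2 S"
proof -
  have "integrable (lebesgue_on S) (\<lambda>x. C\<^sup>2 * (g x)\<^sup>2)"
    using assms(1) by (simp add: L_space_2_iff)
  moreover have "(f x)\<^sup>2 \<le> C\<^sup>2 * (g x)\<^sup>2" for x
    using power_mono[OF assms(3)[of x], of 2] by (simp add: power_mult_distrib)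
  then have "AE x in lebesgue_on S. norm ((f x)\<^sup>2) \<le> norm (C\<^sup>2 * (g x)\<^sup>2)"
    by simp
  moreover have "(\<lambda>x. (f x)\<^sup>2) \<in> borel_measurable (lebesgue_on S)"
    using assms(2) by simp
  ultimately have "integrable (lebesgue_on S) (\<lambda>x. (f x)\<^sup>2)"
    using Bochner_Integration.integrable_bound by blast
  then show ?thesis using assms(2) by (simp add: L_space_2_iff)
qed

text \<open>Integrating \<open>2 (a \<bar>f\<bar>) (b \<bar>g\<bar>) \<le> a\<^sup>2 f\<^sup>2 + b\<^sup>2 g\<^sup>2\<close> and choosing \<open>a\<close> and \<open>b\<close> as the norms of \<open>g\<close> and \<open>f\<close>
  gives the inequality if both norms are positive.\<close>

lemma L_space_2_Cauchy_Schwarz: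
  assumes f: "f \<in> L_space 2 S" and g: "g \<in> L_space 2 S"
  shows "(LINT x|lebesgue_on S. \<bar>f x * g x\<bar>) \<le> L_norm 2 S f * L_norm 2 S g"
proof -
  let ?I = "LINT x|lebesgue_on S. \<bar>f x * g x\<bar>"
  let ?A = "L_norm 2 S f" and ?B = "L_norm 2 S g"
  have key: "2 * a * b * ?I \<le> a\<^sup>2 * ?A\<^sup>2 + b\<^sup>2 * ?B\<^sup>2" if "a \<ge> 0" "b \<ge> 0" for a b
  proof -
    have "2 * a * b * ?I = (LINT x|lebesgue_on S. 2 * a * b * \<bar>f x * g x\<bar>)"
      by simp
    also have "\<dots> \<le> (LINT x|lebesgue_on S. a\<^sup>2 * (f x)\<^sup>2 + b\<^sup>2 * (g x)\<^sup>2)"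
    proof (rule integral_mono)
      show "integrable (lebesgue_on S) (\<lambda>x. 2 * a * b * \<bar>f x * g x\<bar>)"
        using L_space_2_mult_integrable[OF f g] by (intro integrable_mult_right integrable_abs)
      show "integrable (lebesgue_on S) (\<lambda>x. a\<^sup>2 * (f x)\<^sup>2 + b\<^sup>2 * (g x)\<^sup>2)"
        using f g by (simp add: L_space_2_iff)
      show "2 * a * b * \<bar>f x * g x\<bar> \<le> a\<^sup>2 * (f x)\<^sup>2 + b\<^sup>2 * (g x)\<^sup>2" for x
        using sum_squares_bound[of "a * \<bar>f x\<bar>" "b * \<bar>g x\<bar>"]
        by (simp add: power_mult_distrib abs_mult mult_ac)
    qed
    also have "\<dots> = a\<^sup>2 * ?A\<^sup>2 + b\<^sup>2 * ?B\<^sup>2"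
      using f g by (simp add: L_space_2_iff L_norm_2_power2)
    finally show ?thesis .
  qed
  have I0: "0 \<le> ?I" by simp
  have AB: "0 \<le> ?A" "0 \<le> ?B" by (rule L_norm_2_nonneg)+
  show ?thesis
  proof (cases "?A = 0 \<or> ?B = 0")
    case False
    then have "?A * ?B > 0" using AB by simp
    moreover have "(?A * ?B) * ?I \<le> (?A * ?B) * (?A * ?B)"
      using key[OF AB(2,1)] by (simp add: power2_eq_square mult_ac)
    ultimately show ?thesis by (simp only: mult_le_cancel_left_pos)
  next
    case True
    have "?I \<le> 0"
    proof (rule field_le_epsilon)
      fix e :: real assume e: "e > 0"
      \<comment> \<open>one of the two norms vanishes, so the weight of the other may be made small\<close>
      from True show "?I \<le> 0 + e"
      proof
        assume A: "?A = 0"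
        let ?b = "2 * e / (?B\<^sup>2 + 1)"
        have p: "?B\<^sup>2 + 1 > 0" by (simp add: add_nonneg_pos)
        then have b: "?b > 0" using e by simp
        have "?b * (2 * ?I) \<le> ?b * (?b * ?B\<^sup>2)"
          using key[of 1 ?b] A b by (simp add: power2_eq_square mult_ac)
        then have "2 * ?I \<le> ?b * ?B\<^sup>2" using b by (simp only: mult_le_cancel_left_pos)
        also have "\<dots> \<le> 2 * e" using p e by (simp add: field_simps)
        finally show ?thesis by simp
      next
        assume B: "?B = 0"
        let ?b = "2 * e / (?A\<^sup>2 + 1)"
        have p: "?A\<^sup>2 + 1 > 0" by (simp add: add_nonneg_pos)
        then have b: "?b > 0" using e by simp
        have "?b * (2 * ?I) \<le> ?b * (?b * ?A\<^sup>2)"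
          using key[of ?b 1] B b by (simp add: power2_eq_square mult_ac)
        then have "2 * ?I \<le> ?b * ?A\<^sup>2" using b by (simp only: mult_le_cancel_left_pos)
        also have "\<dots> \<le> 2 * e" using p e by (simp add: field_simps)
        finally show ?thesis by simp
      qed
    qed
    then show ?thesis using AB by (meson mult_nonneg_nonneg order_trans)
  qed
qed

lemma L_space_2_Cauchy_Schwarz_abs:
  assumes "f \<in> L_space 2 S" "g \<in> L_space 2 S"
  shows "\<bar>LINT x|lebesgue_on S. f x * g x\<bar> \<le> L_norm 2 S f * L_norm 2 S g"
  using integral_abs_bound[of "lebesgue_on S" "\<lambda>x. f x * g x"] L_space_2_Cauchy_Schwarz[OF assms]
  by linarith

lemma L_norm_2_le_scaled:
  fixes f g :: "'a::euclidean_space \<Rightarrow> real"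
  assumes "g \<in> L_space 2 S" "f \<in> borel_measurable (lebesgue_on S)" "C \<ge> 0"
    and le: "\<And>x. \<bar>f x\<bar> \<le> C * \<bar>g x\<bar>"
  shows "L_norm 2 S f \<le> C * L_norm 2 S g"
proof -
  have "f \<in> L_space 2 S" using assms(1,2) le by (rule L_space_2_dominated)
  then have "(LINT x|lebesgue_on S. (f x)\<^sup>2) \<le> (LINT x|lebesgue_on S. C\<^sup>2 * (g x)\<^sup>2)"
    using assms(1) power_mono[OF le, where n = 2]
    by (intro integral_mono) (auto simp: L_space_2_iff power_mult_distrib)
  also have "\<dots> = (C * L_norm 2 S g)\<^sup>2"
    by (simp add: power_mult_distrib L_norm_2_power2)
  finally have "(L_norm 2 S f)\<^sup>2 \<le> (C * L_norm 2 S g)\<^sup>2"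
    by (simp add: L_norm_2_power2)
  then show ?thesis
    by (rule power2_le_imp_le) (simp add: L_norm_2_nonneg assms(3))
qed

lemma test_functions_L_space_2:
  assumes "\<phi> \<in> test_functions S" "S \<in> sets lebesgue"
  shows "\<phi> \<in> L_space 2 S"
  using locally_integrable_times_test(2)[OF test_functions_locally_integrable[OF assms(1)] assms]
    test_functions_lebesgue[OF assms(1)]
  by (simp add: L_space_2_iff power2_eq_square measurable_restrict_space1)

section \<open>A smooth cutoff\<close>

text \<open>With \<open>y = 1 / (s - M)\<close>, the function \<open>(1 + y) exp (- y)\<close> is the derivative of the convex function
  \<open>(s - M) exp (- y)\<close>, and its own derivative is \<open>y\<^sup>3 exp (- y) \<ge> 0\<close>.  Extended by zero to \<open>s \<le> M\<close>, these
  three functions serve as the multiplier, as the density of the energy and as the slope of the multiplier.\<close>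

definition cutoff :: "real \<Rightarrow> real \<Rightarrow> real" where
  "cutoff M s = flat [:1, 1:] (s - M)"

definition cutoff_primitive :: "real \<Rightarrow> real \<Rightarrow> real" where
  "cutoff_primitive M s = (s - M) * flat 1 (s - M)"

definition cutoff_slope :: "real \<Rightarrow> real \<Rightarrow> real" where
  "cutoff_slope M s = flat [:0, 0, 0, 1:] (s - M)"

lemma flat_shift_has_derivative:
  "((\<lambda>s. flat p (s - M)) has_real_derivative flat ([:0, 0, 1:] * (p - pderiv p)) (s - M)) (at s)"
proof -
  have "((\<lambda>s. s - M) has_real_derivative 1) (at s)"
    by (auto intro!: derivative_eq_intros)
  from DERIV_chain2[OF flat_has_derivative this] show ?thesis by simp
qed

lemma cutoff_has_derivative:
  "(cutoff M has_real_derivative cutoff_slope M s) (at s)"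
  using flat_shift_has_derivative[of "[:1, 1:]" M s]
  by (simp add: cutoff_def[abs_def] cutoff_slope_def pderiv_pCons)

lemma cutoff_primitive_has_derivative:
  "(cutoff_primitive M has_real_derivative cutoff M s) (at s)"
proof -
  have "((\<lambda>s. (s - M) * flat 1 (s - M)) has_real_derivative
      1 * flat 1 (s - M) + (s - M) * flat [:0, 0, 1:] (s - M)) (at s)"
    using flat_shift_has_derivative[of 1 M s]
    by (auto intro!: derivative_eq_intros simp: pderiv_1)
  moreover have "1 * flat 1 (s - M) + (s - M) * flat [:0, 0, 1:] (s - M) = cutoff M s"
  proof (cases "s - M > 0")
    case True
    define d where "d = s - M"
    have "d > 0" using True by (simp add: d_def)
    then have "1 * flat 1 d + d * flat [:0, 0, 1:] d = flat [:1, 1:] d"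
      by (simp add: flat_def field_simps)
    then show ?thesis by (simp add: d_def cutoff_def)
  qed (simp add: flat_def cutoff_def)
  ultimately show ?thesis by (simp add: cutoff_primitive_def[abs_def])
qed

lemma cutoff_nonneg: "0 \<le> cutoff M s"
  by (auto simp: cutoff_def flat_def)

lemma cutoff_eq_0: "s \<le> M \<Longrightarrow> cutoff M s = 0"
  by (simp add: cutoff_def flat_def)

lemma cutoff_primitive_nonneg: "0 \<le> cutoff_primitive M s"
  by (auto simp: cutoff_primitive_def flat_def)

lemma cutoff_primitive_eq_0_iff: "cutoff_primitive M s = 0 \<longleftrightarrow> s \<le> M"
  by (auto simp: cutoff_primitive_def flat_def)

lemma cutoff_le_1: "cutoff M s \<le> 1"
proof (cases "s > M")
  case True
  have "(1 + 1 / (s - M)) * exp (- (1 / (s - M))) \<le> exp (1 / (s - M)) * exp (- (1 / (s - M)))"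
    by (intro mult_right_mono exp_ge_add_one_self) simp
  then show ?thesis
    using True by (simp add: cutoff_def flat_def exp_minus_inverse)
qed (simp add: cutoff_eq_0)

lemma cutoff_slope_bounds: "0 \<le> cutoff_slope M s" "cutoff_slope M s \<le> 27"
proof -
  show "0 \<le> cutoff_slope M s" by (auto simp: cutoff_slope_def flat_def)
  show "cutoff_slope M s \<le> 27"
  proof (cases "s > M")
    case True
    define y where "y = 1 / (s - M)"
    have y: "y > 0" using True by (simp add: y_def)
    \<comment> \<open>The elementary bound \<open>y\<^sup>3 \<le> 27 exp y\<close> is where the constant \<open>27\<close> comes from.\<close>
    have "(y / 3) ^ 3 \<le> (exp (y / 3)) ^ 3"
      using y exp_ge_add_one_self[of "y / 3"] by (intro power_mono) linarith+
    also have "\<dots> = exp y" by (simp add: exp_of_nat_mult[symmetric])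
    finally have le: "y ^ 3 \<le> 27 * exp y" by (simp add: power_divide)
    have "cutoff_slope M s = y ^ 3 * exp (- y)"
      using True by (simp add: cutoff_slope_def flat_def y_def power3_eq_cube)
    also have "\<dots> \<le> 27 * exp y * exp (- y)"
      using le by (intro mult_right_mono) simp_all
    also have "\<dots> = 27" by (simp add: exp_minus_inverse mult.assoc)
    finally show ?thesis .
  qed (simp add: cutoff_slope_def flat_def)
qed

lemma cutoff_mono: "s \<le> t \<Longrightarrow> cutoff M s \<le> cutoff M t"
  by (rule DERIV_nonneg_imp_nondecreasing[where f = "cutoff M"])
    (use cutoff_has_derivative cutoff_slope_bounds in blast)+

lemma lipschitz_by_derivative:
  fixes f f' :: "real \<Rightarrow> real"
  assumes "\<And>s. (f has_real_derivative f' s) (at s)" "\<And>s. \<bar>f' s\<bar> \<le> C"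
  shows "\<bar>f t - f s\<bar> \<le> C * \<bar>t - s\<bar>"
  using field_differentiable_bound[of UNIV f f' C t s] assms
  by (auto simp: has_field_derivative_at_within)

lemma cutoff_lipschitz: "\<bar>cutoff M t - cutoff M s\<bar> \<le> 27 * \<bar>t - s\<bar>"
  using cutoff_slope_bounds by (intro lipschitz_by_derivative[OF cutoff_has_derivative]) simp

lemma cutoff_primitive_lipschitz: "\<bar>cutoff_primitive M t - cutoff_primitive M s\<bar> \<le> \<bar>t - s\<bar>"
  using lipschitz_by_derivative[OF cutoff_primitive_has_derivative, of M 1 t s] cutoff_nonneg cutoff_le_1
  by simp

text \<open>The tangent is taken at \<open>t\<close> and not at \<open>s\<close>: for \<open>s\<close> the earlier and \<open>t\<close> the later of two states, the
  increment of the energy is then controlled by the cutoff of the later state alone.\<close>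

lemma cutoff_primitive_convex:
  "cutoff_primitive M t - cutoff_primitive M s \<le> cutoff M t * (t - s)"
proof -
  consider "s < t" | "t < s" | "s = t" by linarith
  then show ?thesis
  proof cases
    case 1
    then obtain z where "s < z" "z < t" "cutoff_primitive M t - cutoff_primitive M s = (t - s) * cutoff M z"
      using MVT2[of s t "cutoff_primitive M" "cutoff M"] cutoff_primitive_has_derivative by blast
    then show ?thesis using 1 cutoff_mono[of z t M] by (simp add: mult.commute mult_left_mono)
  next
    case 2
    then obtain z where "t < z" "z < s" "cutoff_primitive M s - cutoff_primitive M t = (s - t) * cutoff M z"
      using MVT2[of t s "cutoff_primitive M" "cutoff M"] cutoff_primitive_has_derivative by blast
    moreover from this have "(s - t) * cutoff M t \<le> (s - t) * cutoff M z"
      using 2 cutoff_mono[of t z M] by (intro mult_left_mono) auto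
    ultimately show ?thesis by (simp add: algebra_simps)
  qed simp
qed

lemma smooth_on_cutoff: "smooth_on UNIV (cutoff M)"
proof -
  have "smooth_on UNIV (\<lambda>s::real. s - M)"
    using smooth_on_diff[OF smooth_on_inner[of "1::real"] smooth_on_const[of M]] by simp
  then show ?thesis
    unfolding cutoff_def[abs_def] by (rule smooth_on_compose[OF smooth_on_flat])
qed

lemma cutoff_borel [measurable]: "cutoff M \<in> borel_measurable borel"
  by (intro borel_measurable_continuous_onI smooth_on_imp_continuous smooth_on_cutoff)

lemma cutoff_primitive_borel [measurable]: "cutoff_primitive M \<in> borel_measurable borel"
  using DERIV_continuous_on[OF has_field_derivative_at_within[OF cutoff_primitive_has_derivative], of UNIV M]
  by (intro borel_measurable_continuous_onI) blast

lemma cutoff_compose_test: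
  assumes \<phi>: "\<phi> \<in> test_functions S" and M: "0 \<le> M"
  shows "(\<lambda>x. cutoff M (\<phi> x)) \<in> test_functions S"
proof -
  obtain K where K: "smooth_on UNIV \<phi>" "compact K" "K \<subseteq> S" "\<And>x. x \<notin> K \<Longrightarrow> \<phi> x = 0"
    by (rule test_functionsE[OF \<phi>], rule that) auto
  show ?thesis
    by (rule test_functionsI[OF smooth_on_compose[OF smooth_on_cutoff K(1)] K(2,3)])
      (simp add: K(4) cutoff_eq_0 M)
qed

lemma partial_deriv_cutoff_compose:
  assumes "smooth_on UNIV \<phi>"
  shows "partial_deriv i (\<lambda>x. cutoff M (\<phi> x)) x = cutoff_slope M (\<phi> x) * partial_deriv i \<phi> x"
  using partial_deriv_compose[of "cutoff M" \<phi> x i] smooth_on_imp_differentiable[OF smooth_on_cutoff]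
    smooth_on_imp_differentiable[OF assms] partial_deriv_real_eqI[OF cutoff_has_derivative, of 1]
  by simp

lemma L_space_2_cutoff:
  assumes "f \<in> L_space 2 S" "0 \<le> M"
  shows "(\<lambda>x. cutoff M (f x)) \<in> L_space 2 S"
proof (rule L_space_2_dominated[OF assms(1), where C = 27])
  show "(\<lambda>x. cutoff M (f x)) \<in> borel_measurable (lebesgue_on S)"
    using assms(1) by (auto simp: L_space_2_iff intro: measurable_compose[OF _ cutoff_borel])
  show "\<bar>cutoff M (f x)\<bar> \<le> 27 * \<bar>f x\<bar>" for x
    using cutoff_lipschitz[of M "f x" 0] assms(2) by (simp add: cutoff_eq_0)
qed

lemma L_norm_2_cutoff_diff:
  assumes "f \<in> L_space 2 S" "g \<in> L_space 2 S"
  shows "L_norm 2 S (\<lambda>x. cutoff M (f x) - cutoff M (g x)) \<le> 27 * L_norm 2 S (\<lambda>x. f x - g x)"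
proof (rule L_norm_2_le_scaled[OF L_space_2_diff[OF assms]])
  show "(\<lambda>x. cutoff M (f x) - cutoff M (g x)) \<in> borel_measurable (lebesgue_on S)"
    using assms by (auto simp: L_space_2_iff intro!: borel_measurable_diff measurable_compose[OF _ cutoff_borel])
qed (simp_all add: cutoff_lipschitz)

section \<open>Weak derivatives in Sobolev spaces\<close>

text \<open>Lebesgue measure is complete, so measurability passes from a function to anything that agrees
  with it almost everywhere, in particular to an arbitrarily chosen weak derivative.\<close>

lemma borel_measurable_lebesgue_on_cong_AE:
  fixes f g :: "'a::euclidean_space \<Rightarrow> real"
  assumes S: "S \<in> sets lebesgue" and g: "g \<in> borel_measurable (lebesgue_on S)"
    and fg: "AE x in lebesgue_on S. f x = g x"
  shows "f \<in> borel_measurable (lebesgue_on S)"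
proof -
  have S': "S \<inter> space lebesgue \<in> sets lebesgue" using S by simp
  let ?F = "\<lambda>x. f x * indicator S x" and ?G = "\<lambda>x. g x * indicator S x"
  have G: "?G \<in> borel_measurable lebesgue"
    using g borel_measurable_restrict_space_iff[OF S', of g] by (simp add: mult.commute)
  have eq: "AE x in lebesgue. ?F x = ?G x"
    using fg S by (auto simp: AE_restrict_space_iff indicator_def elim!: eventually_mono)
  have "?F \<in> borel_measurable lebesgue"
  proof (rule measurableI)
    fix A :: "real set" assume A: "A \<in> sets borel"
    have "?G -` A \<inter> space lebesgue \<in> sets lebesgue"
      using G A by (rule measurable_sets)
    then show "?F -` A \<inter> space lebesgue \<in> sets lebesgue"
    proof (rule completion.in_sets_AE[rotated])
      show "AE x in lebesgue. (x \<in> ?G -` A \<inter> space lebesgue) = (x \<in> ?F -` A \<inter> space lebesgue)"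
        using eq by eventually_elim (simp only: Int_iff vimage_eq)
    qed simp
  qed simp
  then show ?thesis
    using borel_measurable_restrict_space_iff[OF S', of f] by (simp add: mult.commute)
qed

lemma L_norm_2_cong_AE:
  assumes "f \<in> borel_measurable (lebesgue_on S)" "g \<in> borel_measurable (lebesgue_on S)"
    "AE x in lebesgue_on S. f x = g x"
  shows "L_norm 2 S f = L_norm 2 S g"
proof -
  have "(LINT x|lebesgue_on S. (f x)\<^sup>2) = (LINT x|lebesgue_on S. (g x)\<^sup>2)"
    using assms by (intro integral_cong_AE) auto
  then show ?thesis by (simp add: L_norm_2)
qed

lemma L_space_2_cong_AE:
  assumes S: "S \<in> sets lebesgue" and g: "g \<in> L_space 2 S" and fg: "AE x in lebesgue_on S. f x = g x"
  shows "f \<in> L_space 2 S"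
proof -
  have m: "f \<in> borel_measurable (lebesgue_on S)"
    using S _ fg by (rule borel_measurable_lebesgue_on_cong_AE) (use g in \<open>simp add: L_space_2_iff\<close>)
  moreover have "integrable (lebesgue_on S) (\<lambda>x. (f x)\<^sup>2)"
    by (rule integrable_cong_AE_imp[of _ "\<lambda>x. (g x)\<^sup>2"])
      (use g m fg in \<open>auto simp: L_space_2_iff elim: eventually_mono\<close>)
  ultimately show ?thesis by (simp add: L_space_2_iff)
qed

text \<open>By uniqueness, the chosen representative of a weak derivative inherits every property of
  some weak derivative that is insensitive to null sets.\<close>

lemma weak_partial_eq_AE:
  assumes "open S" "has_weak_partial S i f g"
  shows "AE x in lebesgue_on S. weak_partial S i f x = g x"
    and "has_weak_partial S i f (weak_partial S i f)"
proof -
  show *: "has_weak_partial S i f (weak_partial S i f)"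
    unfolding weak_partial_def using someI[of "has_weak_partial S i f", OF assms(2)] .
  show "AE x in lebesgue_on S. weak_partial S i f x = g x"
    using assms(1) * assms(2) by (rule has_weak_partial_unique)
qed

lemma H1_space_weak_partial:
  assumes S: "open S" and f: "f \<in> H1_space S" and i: "i \<in> Basis"
  shows "has_weak_partial S i f (weak_partial S i f)" "weak_partial S i f \<in> L_space 2 S"
proof -
  obtain g where g: "g \<in> L_space 2 S" "has_weak_partial S i f g"
    using f i by (auto simp: H1_space_def)
  show "has_weak_partial S i f (weak_partial S i f)"
    using S g(2) by (rule weak_partial_eq_AE)
  show "weak_partial S i f \<in> L_space 2 S"
    using S by (intro L_space_2_cong_AE[OF _ g(1) weak_partial_eq_AE(1)[OF S g(2)]]) auto
qed

text \<open>\<open>H1_norm\<close> is computed with a chosen weak derivative of the difference \<open>f - \<phi>\<close>.  By uniqueness this is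
  the difference of the chosen weak derivative of \<open>f\<close> and the classical derivative of \<open>\<phi>\<close>, almost
  everywhere.\<close>

lemma H10_space_approx:
  assumes S: "open S" and f: "f \<in> H10_space S" and e: "\<epsilon> > 0"
  obtains \<phi> where "\<phi> \<in> test_functions S" "L_norm 2 S (\<lambda>x. f x - \<phi> x) < \<epsilon>"
    "(\<Sum>i\<in>Basis. (L_norm 2 S (\<lambda>x. weak_partial S i f x - partial_deriv i \<phi> x))\<^sup>2) < \<epsilon>\<^sup>2"
proof -
  have Sl: "S \<in> sets lebesgue" using S by auto
  have fH: "f \<in> H1_space S" using f by (simp add: H10_space_def closure_wrt_def)
  obtain \<phi> where \<phi>: "\<phi> \<in> test_functions S" and H: "H1_norm S (\<lambda>x. f x - \<phi> x) < \<epsilon>"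
    using f e by (auto simp: H10_space_def closure_wrt_def)
  have eq: "L_norm 2 S (weak_partial S i (\<lambda>x. f x - \<phi> x))
      = L_norm 2 S (\<lambda>x. weak_partial S i f x - partial_deriv i \<phi> x)" if i: "i \<in> Basis" for i
  proof -
    have ae: "AE x in lebesgue_on S. weak_partial S i (\<lambda>x. f x - \<phi> x) x = weak_partial S i f x - partial_deriv i \<phi> x"
      using S has_weak_partial_diff[OF H1_space_weak_partial(1)[OF S fH i] has_weak_partial_test[OF \<phi> i Sl] i Sl]
      by (rule weak_partial_eq_AE(1))
    have L: "(\<lambda>x. weak_partial S i f x - partial_deriv i \<phi> x) \<in> L_space 2 S"
      by (intro L_space_2_diff H1_space_weak_partial(2)[OF S fH i]
          test_functions_L_space_2[OF partial_deriv_test_functions[OF \<phi> i] Sl])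
    show ?thesis
      using L_space_2_cong_AE[OF Sl L ae] L ae by (intro L_norm_2_cong_AE) (simp_all add: L_space_2_iff)
  qed
  let ?s = "(\<Sum>i\<in>Basis. (L_norm 2 S (\<lambda>x. weak_partial S i f x - partial_deriv i \<phi> x))\<^sup>2)"
  let ?n = "(L_norm 2 S (\<lambda>x. f x - \<phi> x))\<^sup>2"
  have s0: "0 \<le> ?s" by (intro sum_nonneg) simp
  have "sqrt (?n + ?s) < \<epsilon>"
    using H by (simp add: H1_norm_def eq)
  then have "(sqrt (?n + ?s))\<^sup>2 < \<epsilon>\<^sup>2"
    using s0 by (intro power_strict_mono real_sqrt_ge_zero add_nonneg_nonneg) simp_all
  moreover have "(sqrt (?n + ?s))\<^sup>2 = ?n + ?s"
    using s0 by (intro real_sqrt_pow2 add_nonneg_nonneg) simp_all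
  ultimately have lt: "?n + ?s < \<epsilon>\<^sup>2" by simp
  have "?n < \<epsilon>\<^sup>2" using lt s0 by linarith
  then have "L_norm 2 S (\<lambda>x. f x - \<phi> x) < \<epsilon>"
    by (rule power2_less_imp_less) (use e in linarith)
  moreover have "?s < \<epsilon>\<^sup>2" using lt zero_le_power2[of "L_norm 2 S (\<lambda>x. f x - \<phi> x)"] by linarith
  ultimately show ?thesis by (rule that[OF \<phi>])
qed

section \<open>The elliptic inequality\<close>

lemma laplacian_L_space_2:
  assumes "open S" "v \<in> H2_space S"
  shows "laplacian S v \<in> L_space 2 S"
  unfolding laplacian_def[abs_def]
  using assms by (intro L_space_2_sum finite_Basis H1_space_weak_partial(2)) (auto simp: H2_space_def)

text \<open>The Laplacian is tested with the cutoff of an approximating test function \<open>\<phi>\<close>.  If \<open>w\<close> is a partial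
  derivative of \<open>v\<close> and \<open>p\<close> that of \<open>\<phi>\<close>, then \<open>- w p \<le> (w - p)\<^sup>2 / 4\<close> bounds the integral from above by
  a multiple of the squared distance in \<open>H\<^sup>1\<close>.  Replacing \<open>\<phi>\<close> by \<open>v\<close>
  inside the cutoff costs a multiple of the distance in \<open>L\<^sup>2\<close>.\<close>

lemma integral_laplacian_cutoff_nonpos:
  assumes S: "open S" and v2: "v \<in> H2_space S" and v0: "v \<in> H10_space S" and M: "0 \<le> M"
  shows "(LINT x|lebesgue_on S. laplacian S v x * cutoff M (v x)) \<le> 0"
proof -
  let ?I = "LINT x|lebesgue_on S. laplacian S v x * cutoff M (v x)"
  have Sl: "S \<in> sets lebesgue" using S by auto
  define w where "w i = weak_partial S i v" for i
  define z where "z i = weak_partial S i (w i)" for i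
  have v1: "v \<in> H1_space S" using v2 by (simp add: H2_space_def)
  then have vL: "v \<in> L_space 2 S" by (simp add: H1_space_def)
  have wL: "w i \<in> L_space 2 S" if "i \<in> Basis" for i
    unfolding w_def using S v1 that by (rule H1_space_weak_partial)
  have wH: "w i \<in> H1_space S" if "i \<in> Basis" for i
    using v2 that by (simp add: H2_space_def w_def)
  have z: "has_weak_partial S i (w i) (z i)" "z i \<in> L_space 2 S" if "i \<in> Basis" for i
    unfolding z_def using H1_space_weak_partial[OF S wH[OF that] that] by auto
  have lap: "laplacian S v x = (\<Sum>i\<in>Basis. z i x)" for x
    by (simp add: laplacian_def z_def w_def)
  have lapL: "laplacian S v \<in> L_space 2 S"
    using S v2 by (rule laplacian_L_space_2)
  let ?L = "L_norm 2 S (laplacian S v)"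
  have bound: "?I \<le> 27 / 4 * \<epsilon>\<^sup>2 + ?L * (27 * \<epsilon>)" if e: "\<epsilon> > 0" for \<epsilon>
  proof -
    obtain \<phi> where \<phi>: "\<phi> \<in> test_functions S" and near: "L_norm 2 S (\<lambda>x. v x - \<phi> x) < \<epsilon>"
      and near': "(\<Sum>i\<in>Basis. (L_norm 2 S (\<lambda>x. w i x - partial_deriv i \<phi> x))\<^sup>2) < \<epsilon>\<^sup>2"
      unfolding w_def by (rule H10_space_approx[OF S v0 e])
    let ?g = "\<lambda>x. cutoff M (\<phi> x)"
    have g: "?g \<in> test_functions S" using \<phi> M by (rule cutoff_compose_test)
    have gL: "?g \<in> L_space 2 S" using g Sl by (rule test_functions_L_space_2)
    have \<phi>L: "\<phi> \<in> L_space 2 S" using \<phi> Sl by (rule test_functions_L_space_2)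
    have vgL: "(\<lambda>x. cutoff M (v x)) \<in> L_space 2 S" using vL M by (rule L_space_2_cutoff)
    have part: "(LINT x|lebesgue_on S. z i x * ?g x)
        \<le> 27 / 4 * (L_norm 2 S (\<lambda>x. w i x - partial_deriv i \<phi> x))\<^sup>2" if i: "i \<in> Basis" for i
    proof -
      have pL: "partial_deriv i \<phi> \<in> L_space 2 S" "partial_deriv i ?g \<in> L_space 2 S"
        by (intro test_functions_L_space_2 partial_deriv_test_functions \<phi> g i Sl)+
      have "(LINT x|lebesgue_on S. z i x * ?g x) = - (LINT x|lebesgue_on S. w i x * partial_deriv i ?g x)"
        using z(1)[OF i] g by (simp add: has_weak_partial_def)
      also have "\<dots> = (LINT x|lebesgue_on S. - (w i x * partial_deriv i ?g x))"
        by simp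
      also have "\<dots> \<le> (LINT x|lebesgue_on S. 27 / 4 * (w i x - partial_deriv i \<phi> x)\<^sup>2)"
      proof (rule integral_mono)
        show "integrable (lebesgue_on S) (\<lambda>x. - (w i x * partial_deriv i ?g x))"
          using L_space_2_mult_integrable[OF wL[OF i] pL(2)] by simp
        show "integrable (lebesgue_on S) (\<lambda>x. 27 / 4 * (w i x - partial_deriv i \<phi> x)\<^sup>2)"
          using L_space_2_diff[OF wL[OF i] pL(1)] by (simp add: L_space_2_iff)
        fix x
        let ?w = "w i x" and ?p = "partial_deriv i \<phi> x" and ?s = "cutoff_slope M (\<phi> x)"
        have "- (?w * ?p) \<le> (?w - ?p)\<^sup>2 / 4"
          using zero_le_power2[of "?w + ?p"] by (simp add: power2_eq_square algebra_simps)
        then have "?s * - (?w * ?p) \<le> ?s * ((?w - ?p)\<^sup>2 / 4)"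
          by (intro mult_left_mono cutoff_slope_bounds)
        also have "\<dots> \<le> 27 * ((?w - ?p)\<^sup>2 / 4)"
          by (intro mult_right_mono cutoff_slope_bounds) simp
        finally show "- (?w * partial_deriv i ?g x) \<le> 27 / 4 * (?w - ?p)\<^sup>2"
          by (simp add: partial_deriv_cutoff_compose[OF test_functions_smooth[OF \<phi>]] mult_ac)
      qed
      finally show ?thesis by (simp add: L_norm_2_power2)
    qed
    have "(LINT x|lebesgue_on S. laplacian S v x * ?g x) = (\<Sum>i\<in>Basis. LINT x|lebesgue_on S. z i x * ?g x)"
      unfolding lap sum_distrib_right
      by (rule Bochner_Integration.integral_sum) (intro L_space_2_mult_integrable z(2) gL)
    also have "\<dots> \<le> (\<Sum>i\<in>Basis. 27 / 4 * (L_norm 2 S (\<lambda>x. w i x - partial_deriv i \<phi> x))\<^sup>2)"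
      by (intro sum_mono part)
    also have "\<dots> \<le> 27 / 4 * \<epsilon>\<^sup>2"
      using near' unfolding sum_distrib_left[symmetric] by (intro mult_left_mono) auto
    finally have 1: "(LINT x|lebesgue_on S. laplacian S v x * ?g x) \<le> 27 / 4 * \<epsilon>\<^sup>2" .
    have "?I - (LINT x|lebesgue_on S. laplacian S v x * ?g x)
        = (LINT x|lebesgue_on S. laplacian S v x * (cutoff M (v x) - ?g x))"
      using L_space_2_mult_integrable[OF lapL vgL] L_space_2_mult_integrable[OF lapL gL]
      by (simp add: right_diff_distrib)
    also have "\<dots> \<le> ?L * L_norm 2 S (\<lambda>x. cutoff M (v x) - ?g x)"
      using L_space_2_Cauchy_Schwarz_abs[OF lapL L_space_2_diff[OF vgL gL]] by linarith
    also have "\<dots> \<le> ?L * (27 * \<epsilon>)"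
      using L_norm_2_cutoff_diff[OF vL \<phi>L, of M] near
      by (intro mult_left_mono L_norm_2_nonneg) linarith
    finally show ?thesis using 1 by linarith
  qed
  have "((\<lambda>\<epsilon>. 27 / 4 * \<epsilon>\<^sup>2 + ?L * (27 * \<epsilon>)) \<longlongrightarrow> 27 / 4 * 0\<^sup>2 + ?L * (27 * 0)) (at_right 0)"
    by (intro tendsto_intros)
  moreover have "\<forall>\<^sub>F \<epsilon> in at_right 0. ?I \<le> 27 / 4 * \<epsilon>\<^sup>2 + ?L * (27 * \<epsilon>)"
    using bound by (auto simp: eventually_at_right_field intro: exI[of _ 1])
  ultimately have "?I \<le> 27 / 4 * 0\<^sup>2 + ?L * (27 * 0)"
    by (rule tendsto_lowerbound) simp
  then show ?thesis by simp
qed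

section \<open>Weak derivatives in time\<close>

lemma flat_1_has_derivative: "(flat 1 has_real_derivative flat [:0, 0, 1:] s) (at s)"
  using flat_has_derivative[of 1 s] by (simp add: pderiv_1)

lemma flat_1_mono: "s \<le> t \<Longrightarrow> flat 1 s \<le> flat 1 t"
  by (rule DERIV_nonneg_imp_nondecreasing[where f = "flat 1"])
    (use flat_1_has_derivative in \<open>auto simp: flat_def intro!: exI\<close>)

text \<open>As \<open>flat 1 x\<close> increases past \<open>exp (- 1)\<close> at \<open>x = 1\<close>, the second term becomes exactly zero there.
  So this is a smooth function that is zero up to \<open>0\<close> and a positive constant from \<open>1\<close> on.\<close>

definition smooth_step :: "real \<Rightarrow> real" where
  "smooth_step x = flat 1 (exp (- 1)) - flat 1 (exp (- 1) - flat 1 x)"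

definition smooth_step_slope :: "real \<Rightarrow> real" where
  "smooth_step_slope x = flat [:0, 0, 1:] (exp (- 1) - flat 1 x) * flat [:0, 0, 1:] x"

lemma smooth_step_has_derivative: "(smooth_step has_real_derivative smooth_step_slope x) (at x)"
proof -
  have "((\<lambda>x. exp (- 1) - flat 1 x) has_real_derivative - flat [:0, 0, 1:] x) (at x)"
    using flat_1_has_derivative[of x] by (auto intro!: derivative_eq_intros)
  from DERIV_chain2[OF flat_1_has_derivative this]
  have "((\<lambda>x. flat 1 (exp (- 1) - flat 1 x)) has_real_derivative - smooth_step_slope x) (at x)"
    by (simp add: smooth_step_slope_def)
  then show ?thesis
    unfolding smooth_step_def[abs_def] by (auto intro!: derivative_eq_intros)
qed

lemma smooth_step_smooth: "smooth_on UNIV smooth_step"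
  unfolding smooth_step_def[abs_def]
  by (intro smooth_on_diff smooth_on_const smooth_on_compose[OF smooth_on_flat] smooth_on_flat)

lemma smooth_step_slope_smooth: "smooth_on UNIV smooth_step_slope"
  unfolding smooth_step_slope_def[abs_def]
  by (intro smooth_on_mult smooth_on_diff smooth_on_const smooth_on_compose[OF smooth_on_flat] smooth_on_flat)

lemma flat_1_at_1: "flat 1 1 = exp (- 1)"
  by (simp add: flat_def)

lemma smooth_step_eq_0: "x \<le> 0 \<Longrightarrow> smooth_step x = 0"
  by (simp add: smooth_step_def flat_def)

lemma smooth_step_const: "1 \<le> x \<Longrightarrow> smooth_step x = smooth_step 1"
  using flat_1_mono[of 1 x] flat_1_at_1 by (simp add: smooth_step_def) (simp add: flat_def)

lemma smooth_step_1_pos: "0 < smooth_step 1"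
  by (simp add: smooth_step_def flat_def)

lemma smooth_step_slope_nonneg: "0 \<le> smooth_step_slope x"
  by (simp add: smooth_step_slope_def flat_def)

lemma smooth_step_slope_eq_0: "x \<notin> {0..1} \<Longrightarrow> smooth_step_slope x = 0"
  using flat_1_mono[of 1 x] flat_1_at_1
  by (cases "x < 0") (simp_all add: smooth_step_slope_def flat_def not_less split: if_splits)

lemma smooth_step_bounded: "\<bar>smooth_step x\<bar> \<le> 1"
proof -
  have "flat 1 (exp (- 1) - flat 1 x) \<le> flat 1 (exp (- 1))"
    by (intro flat_1_mono) (simp add: flat_1_bounds)
  then show ?thesis
    using flat_1_bounds[of "exp (- 1)"] flat_1_bounds[of "exp (- 1) - flat 1 x"]
    by (simp add: smooth_step_def)
qed

lemma smooth_on_affine_time: "smooth_on UNIV (\<lambda>x::real. c * (x - s))"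
proof -
  have "smooth_on UNIV (\<lambda>x::real. c * (x \<bullet> 1 - s))"
    by (intro smooth_on_mult smooth_on_diff smooth_on_const smooth_on_inner)
  then show ?thesis by simp
qed

text \<open>For large \<open>n\<close>, an approximate point mass at \<open>s\<close> of total weight \<open>smooth_step 1\<close>, supported to the right of \<open>s\<close>.\<close>

definition time_kernel :: "nat \<Rightarrow> real \<Rightarrow> real \<Rightarrow> real" where
  "time_kernel n s x = real n * smooth_step_slope (real n * (x - s))"

lemma time_kernel_has_antiderivative:
  "((\<lambda>x. smooth_step (real n * (x - s))) has_real_derivative time_kernel n s x) (at x)"
proof -
  have "((\<lambda>x. real n * (x - s)) has_real_derivative real n) (at x)"
    by (auto intro!: derivative_eq_intros)
  from DERIV_chain2[OF smooth_step_has_derivative this] show ?thesis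
    by (simp add: time_kernel_def mult.commute)
qed

lemma time_kernel_nonneg: "0 \<le> time_kernel n s x"
  by (simp add: time_kernel_def smooth_step_slope_nonneg)

lemma time_kernel_eq_0:
  assumes "n > 0" "x \<notin> {s..s + 1 / real n}" shows "time_kernel n s x = 0"
proof -
  have "real n * (x - s) \<notin> {0..1}"
    using assms by (auto simp: field_simps zero_le_mult_iff)
  then show ?thesis by (simp add: time_kernel_def smooth_step_slope_eq_0)
qed

lemma time_kernel_smooth: "smooth_on UNIV (time_kernel n s)"
  unfolding time_kernel_def[abs_def]
  by (intro smooth_on_mult smooth_on_const smooth_on_compose[OF smooth_step_slope_smooth] smooth_on_affine_time)

lemma time_kernel_test:
  assumes "n > 0" "{s..s + 1 / real n} \<subseteq> I" shows "time_kernel n s \<in> test_functions I"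
  by (rule test_functionsI[OF time_kernel_smooth _ assms(2)]) (auto intro: time_kernel_eq_0[OF assms(1)])

lemma continuous_locally_integrable:
  assumes "continuous_on I a" shows "locally_integrable I a"
  unfolding locally_integrable_def set_integrable_def
proof (intro allI impI)
  fix K assume K: "compact K" "K \<subseteq> I"
  then have "integrable lborel (\<lambda>x. indicator K x *\<^sub>R a x)"
    using assms by (intro borel_integrable_compact continuous_on_subset[OF assms])
  then show "integrable lebesgue (\<lambda>x. indicator K x *\<^sub>R a x)"
    by (subst integrable_completion) (auto dest: borel_measurable_integrable)
qed

lemma integral_time_kernel:
  assumes n: "n > 0" and I: "{s..s + 1 / real n} \<subseteq> I" "I \<in> sets lebesgue"
  shows "(LINT x|lebesgue_on I. time_kernel n s x) = smooth_step 1"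
proof -
  have t: "time_kernel n s \<in> test_functions I" using n I(1) by (rule time_kernel_test)
  have "(LINT x|lebesgue_on I. 1 * time_kernel n s x) = (LINT x|lebesgue. 1 * time_kernel n s x)"
    by (intro locally_integrable_times_test(3)[OF _ t I(2)] continuous_locally_integrable continuous_on_const)
  also have "\<dots> = (LINT x|lborel. time_kernel n s x)"
    using test_functions_borel[OF t] by (simp add: integral_completion)
  also have "\<dots> = (LINT x|lborel. indicator {s..s + 1 / real n} x *\<^sub>R time_kernel n s x)"
    using time_kernel_eq_0[OF n] by (intro Bochner_Integration.integral_cong) (auto simp: indicator_def)
  also have "\<dots> = smooth_step (real n * (s + 1 / real n - s)) - smooth_step (real n * (s - s))"
    by (rule integral_FTC_Icc)
      (use n in \<open>auto intro!: smooth_on_imp_continuous time_kernel_smooth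
        has_field_derivative_at_within[OF time_kernel_has_antiderivative]
        simp: has_real_derivative_iff_has_vector_derivative[symmetric]\<close>)
  also have "\<dots> = smooth_step 1"
    using n by (simp add: smooth_step_eq_0)
  finally show ?thesis by simp
qed

lemma time_kernel_tendsto:
  assumes a: "continuous_on I a" and I: "open I" and s: "s \<in> I"
  shows "(\<lambda>n. LINT x|lebesgue_on I. a x * time_kernel n s x) \<longlonglongrightarrow> a s * smooth_step 1"
proof (rule LIMSEQ_I)
  fix e :: real assume e: "0 < e"
  have Il: "I \<in> sets lebesgue" using I by auto
  define e' where "e' = e / (2 * smooth_step 1)"
  have e': "e' > 0" using e smooth_step_1_pos by (simp add: e'_def)
  have "isCont a s" using a I s by (simp add: continuous_on_eq_continuous_at)
  then obtain d where d: "d > 0" "\<And>x. \<bar>x - s\<bar> < d \<Longrightarrow> \<bar>a x - a s\<bar> < e'"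
    using e' unfolding continuous_at_eps_delta dist_real_def by blast
  obtain d' where d': "d' > 0" "\<And>x. \<bar>x - s\<bar> < d' \<Longrightarrow> x \<in> I"
    using I s unfolding open_dist dist_real_def by blast
  obtain N where N: "N > 0" "1 / real N < min d d'"
    using real_arch_invD[of "min d d'"] d(1) d'(1) by (auto simp: inverse_eq_divide)
  show "\<exists>N. \<forall>n\<ge>N. norm ((LINT x|lebesgue_on I. a x * time_kernel n s x) - a s * smooth_step 1) < e"
  proof (intro exI allI impI)
    fix n assume n: "N \<le> n"
    then have n0: "n > 0" using N by simp
    have "1 / real n \<le> 1 / real N" using n N(1) by (simp add: field_simps)
    then have near: "1 / real n < d" "1 / real n < d'" using N(2) by simp_all
    have sub: "{s..s + 1 / real n} \<subseteq> I" using near(2) d'(2) by auto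
    have t: "time_kernel n s \<in> test_functions I" using n0 sub by (rule time_kernel_test)
    have int: "integrable (lebesgue_on I) (\<lambda>x. a x * time_kernel n s x)"
      "integrable (lebesgue_on I) (\<lambda>x. a s * time_kernel n s x)"
      "integrable (lebesgue_on I) (\<lambda>x. e' * time_kernel n s x)"
      by (intro locally_integrable_times_test(2)[OF _ t Il] continuous_locally_integrable a continuous_on_const)+
    have "\<bar>(LINT x|lebesgue_on I. a x * time_kernel n s x) - a s * smooth_step 1\<bar>
        = \<bar>LINT x|lebesgue_on I. a x * time_kernel n s x - a s * time_kernel n s x\<bar>"
      using int by (simp add: integral_time_kernel[OF n0 sub Il])
    also have "\<dots> \<le> (LINT x|lebesgue_on I. \<bar>a x * time_kernel n s x - a s * time_kernel n s x\<bar>)"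
      by (rule integral_abs_bound)
    also have "\<dots> \<le> (LINT x|lebesgue_on I. e' * time_kernel n s x)"
    proof (rule integral_mono)
      show "\<bar>a x * time_kernel n s x - a s * time_kernel n s x\<bar> \<le> e' * time_kernel n s x" for x
      proof (cases "x \<in> {s..s + 1 / real n}")
        case True
        then have "\<bar>a x - a s\<bar> \<le> e'" using near(1) by (intro less_imp_le d(2)) auto
        then show ?thesis
          using time_kernel_nonneg[of n s x]
          by (simp add: left_diff_distrib[symmetric] abs_mult mult_right_mono)
      qed (simp add: time_kernel_eq_0[OF n0])
    qed (use int in auto)
    also have "\<dots> = e' * smooth_step 1"
      by (simp add: integral_time_kernel[OF n0 sub Il])
    also have "\<dots> < e"
      using e smooth_step_1_pos by (simp add: e'_def)
    finally show "norm ((LINT x|lebesgue_on I. a x * time_kernel n s x) - a s * smooth_step 1) < e"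
      by simp
  qed
qed

text \<open>Testing a weak derivative against smoothed indicators of \<open>[s, t]\<close>, whose derivatives are
  approximate point masses at the end points, gives the fundamental theorem of calculus.\<close>

lemma weak_derivative_increment:
  fixes a b :: "real \<Rightarrow> real"
  assumes I: "open I" and a: "continuous_on I a" and b: "integrable (lebesgue_on I) b"
    and weak: "\<And>\<phi>. \<phi> \<in> test_functions I \<Longrightarrow>
      (LINT x|lebesgue_on I. deriv \<phi> x * a x) = - (LINT x|lebesgue_on I. \<phi> x * b x)"
    and st: "s < t" "{s..t} \<subseteq> I"
  shows "a t - a s = (LINT x|lebesgue_on I. indicator {s<..t} x * b x)"
proof -
  have Il: "I \<in> sets lebesgue" using I by auto
  have "t \<in> I" "s \<in> I" using st by auto
  obtain d where d: "d > 0" "\<And>x. \<bar>x - t\<bar> < d \<Longrightarrow> x \<in> I"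
    using I \<open>t \<in> I\<close> unfolding open_dist dist_real_def by blast
  obtain d' where d': "d' > 0" "\<And>x. \<bar>x - s\<bar> < d' \<Longrightarrow> x \<in> I"
    using I \<open>s \<in> I\<close> unfolding open_dist dist_real_def by blast
  obtain N where N: "N > 0" "1 / real N < min d d'"
    using real_arch_invD[of "min d d'"] d(1) d'(1) by (auto simp: inverse_eq_divide)
  define \<phi> where "\<phi> n x = smooth_step (real n * (x - s)) - smooth_step (real n * (x - t))" for n x
  let ?c = "smooth_step 1"
  have D: "(\<phi> n has_real_derivative (time_kernel n s x - time_kernel n t x)) (at x)" for n x
    unfolding \<phi>_def[abs_def] by (intro DERIV_diff time_kernel_has_antiderivative)
  have smooth: "smooth_on UNIV (\<phi> n)" for n
    unfolding \<phi>_def[abs_def]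
    by (intro smooth_on_diff smooth_on_compose[OF smooth_step_smooth] smooth_on_affine_time)
  have eq: "(LINT x|lebesgue_on I. a x * time_kernel n s x) - (LINT x|lebesgue_on I. a x * time_kernel n t x)
      = - (LINT x|lebesgue_on I. \<phi> n x * b x)" if n: "n \<ge> N" for n
  proof -
    have n0: "n > 0" using n N by simp
    have "1 / real n \<le> 1 / real N" using n N(1) by (simp add: field_simps)
    then have near: "1 / real n < d" "1 / real n < d'" using N(2) by simp_all
    have sub: "{s..s + 1 / real n} \<subseteq> I" "{t..t + 1 / real n} \<subseteq> I"
      using near d(2) d'(2) by auto
    have "{s..t + 1 / real n} \<subseteq> {s..t} \<union> {t..t + 1 / real n}" by auto
    then have sub': "{s..t + 1 / real n} \<subseteq> I" using sub(2) st(2) by blast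
    have "\<phi> n \<in> test_functions I"
    proof (rule test_functionsI[OF smooth compact_Icc sub'])
      fix x assume "x \<notin> {s..t + 1 / real n}"
      then consider "x < s" | "t + 1 / real n < x" by fastforce
      then show "\<phi> n x = 0"
      proof cases
        case 1
        then have "real n * (x - s) \<le> 0" "real n * (x - t) \<le> 0"
          using st(1) by (auto simp: mult_le_0_iff)
        then show ?thesis by (simp add: \<phi>_def smooth_step_eq_0)
      next
        case 2
        then have "1 \<le> real n * (x - t)" using n0 by (simp add: field_simps)
        moreover have "real n * (x - t) \<le> real n * (x - s)" using st(1) by (simp add: mult_left_mono)
        ultimately show ?thesis
          using smooth_step_const[of "real n * (x - t)"] smooth_step_const[of "real n * (x - s)"]
          by (simp add: \<phi>_def)
      qed
    qed
    from weak[OF this] have "(LINT x|lebesgue_on I. (time_kernel n s x - time_kernel n t x) * a x)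
        = - (LINT x|lebesgue_on I. \<phi> n x * b x)"
      by (simp add: DERIV_imp_deriv[OF D])
    moreover have "integrable (lebesgue_on I) (\<lambda>x. a x * time_kernel n s x)"
      "integrable (lebesgue_on I) (\<lambda>x. a x * time_kernel n t x)"
      using continuous_locally_integrable[OF a] time_kernel_test[OF n0] sub Il
      by (auto intro: locally_integrable_times_test(2))
    ultimately show ?thesis by (simp add: algebra_simps)
  qed
  \<comment> \<open>The step is zero at \<open>0\<close>, hence the limit contains the right end point and not the left one.\<close>
  have lim: "(\<lambda>n. \<phi> n x) \<longlonglongrightarrow> ?c * indicator {s<..t} x" for x
  proof -
    have pos: "\<forall>\<^sub>F n in sequentially. smooth_step (real n * (x - r)) = ?c" if "x > r" for r
    proof -
      obtain N where N: "1 / (x - r) \<le> real N" using real_arch_simple by blast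
      show ?thesis
      proof (rule eventually_sequentiallyI[of N])
        fix n assume "N \<le> n"
        then have "1 / (x - r) \<le> real n" using N by simp
        then have "1 \<le> real n * (x - r)" using that by (simp add: field_simps)
        then show "smooth_step (real n * (x - r)) = ?c" by (rule smooth_step_const)
      qed
    qed
    have neg: "smooth_step (real n * (x - r)) = 0" if "x \<le> r" for r n
      using that by (intro smooth_step_eq_0) (simp add: mult_le_0_iff)
    consider "x \<le> s" | "s < x" "x \<le> t" | "t < x" by linarith
    then have "\<forall>\<^sub>F n in sequentially. \<phi> n x = ?c * indicator {s<..t} x"
    proof cases
      case 1
      then show ?thesis using st(1) neg by (auto simp: \<phi>_def)
    next
      case 2
      then show ?thesis using neg[of t] pos[of s] by (auto simp: \<phi>_def elim!: eventually_mono)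
    next
      case 3
      have "\<forall>\<^sub>F n in sequentially. smooth_step (real n * (x - t)) = ?c \<and> smooth_step (real n * (x - s)) = ?c"
        using pos[of t] pos[of s] 3 st(1) by (intro eventually_conj) auto
      then show ?thesis using 3 by (auto simp: \<phi>_def elim!: eventually_mono)
    qed
    then show ?thesis by (rule tendsto_eventually)
  qed
  have bm [measurable]: "b \<in> borel_measurable (lebesgue_on I)"
    using b by (rule borel_measurable_integrable)
  have \<phi>m [measurable]: "\<phi> n \<in> borel_measurable (lebesgue_on I)" for n
    by (intro continuous_imp_measurable_on_sets_lebesgue smooth_on_imp_continuous smooth Il)
  have im [measurable]: "(\<lambda>x. indicator {s<..t} x :: real) \<in> borel_measurable (lebesgue_on I)"
    by (intro measurable_restrict_space1 borel_measurable_indicator) auto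
  have L: "(\<lambda>n. LINT x|lebesgue_on I. \<phi> n x * b x)
      \<longlonglongrightarrow> (LINT x|lebesgue_on I. ?c * indicator {s<..t} x * b x)"
  proof (rule integral_dominated_convergence)
    show "integrable (lebesgue_on I) (\<lambda>x. 2 * \<bar>b x\<bar>)" using b by simp
    show "AE x in lebesgue_on I. (\<lambda>n. \<phi> n x * b x) \<longlonglongrightarrow> ?c * indicator {s<..t} x * b x"
      by (intro AE_I2 tendsto_mult lim tendsto_const)
    show "AE x in lebesgue_on I. norm (\<phi> n x * b x) \<le> 2 * \<bar>b x\<bar>" for n
    proof (rule AE_I2)
      fix x
      have "\<bar>\<phi> n x\<bar> \<le> 2"
        using smooth_step_bounded[of "real n * (x - s)"] smooth_step_bounded[of "real n * (x - t)"]
        unfolding \<phi>_def by linarith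
      then show "norm (\<phi> n x * b x) \<le> 2 * \<bar>b x\<bar>" by (simp add: abs_mult mult_right_mono)
    qed
  qed measurable
  have "(\<lambda>n. - (LINT x|lebesgue_on I. \<phi> n x * b x)) \<longlonglongrightarrow> a s * ?c - a t * ?c"
  proof (rule Lim_transform_eventually)
    show "(\<lambda>n. (LINT x|lebesgue_on I. a x * time_kernel n s x) - (LINT x|lebesgue_on I. a x * time_kernel n t x))
        \<longlonglongrightarrow> a s * ?c - a t * ?c"
      by (intro tendsto_diff time_kernel_tendsto a I \<open>s \<in> I\<close> \<open>t \<in> I\<close>)
    show "\<forall>\<^sub>F n in sequentially. (LINT x|lebesgue_on I. a x * time_kernel n s x)
        - (LINT x|lebesgue_on I. a x * time_kernel n t x) = - (LINT x|lebesgue_on I. \<phi> n x * b x)"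
      using eq by (rule eventually_sequentiallyI)
  qed
  from LIMSEQ_unique[OF this tendsto_minus[OF L]]
  have "?c * (a t - a s) = ?c * (LINT x|lebesgue_on I. indicator {s<..t} x * b x)"
    by (simp add: algebra_simps)
  then show ?thesis using smooth_step_1_pos by simp
qed

section \<open>The energy estimate\<close>

text \<open>The simple functions that approximate \<open>v\<close> become simple real functions after pairing with \<open>g\<close>.  They
  converge almost everywhere only, which suffices by completeness of Lebesgue measure.\<close>

lemma Bochner_inner_measurable:
  assumes I: "I \<in> sets lebesgue" and v: "strongly_measurable I (L_space 2 S) (L_norm 2 S) v"
    and g: "g \<in> L_space 2 S"
  shows "(\<lambda>t. LINT x|lebesgue_on S. v t x * g x) \<in> borel_measurable (lebesgue_on I)"
proof -
  obtain s where s: "\<And>n. simple_function (lebesgue_on I) (s n)" "\<And>n. s n ` I \<subseteq> L_space 2 S"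
    and conv: "AE t in lebesgue_on I. v t \<in> L_space 2 S \<and> (\<lambda>n::nat. L_norm 2 S (\<lambda>x. s n t x - v t x)) \<longlonglongrightarrow> 0"
    using v unfolding strongly_measurable_def by blast
  define b where "b n t = (LINT x|lebesgue_on S. s n t x * g x)" for n t
  have b: "b n \<in> borel_measurable (lebesgue_on I)" for n
    unfolding b_def[abs_def]
    using simple_function_compose1[OF s(1), of "\<lambda>f. LINT x|lebesgue_on S. f x * g x" n]
    by (rule borel_measurable_simple_function)
  have "AE t in lebesgue_on I. t \<in> I"
    using AE_space[of "lebesgue_on I"] by (auto elim: eventually_mono)
  then have "AE t in lebesgue_on I. (LINT x|lebesgue_on S. v t x * g x) = lim (\<lambda>n. b n t)"
    using conv
  proof eventually_elim
    fix t
    assume "t \<in> I" and t: "v t \<in> L_space 2 S \<and> (\<lambda>n. L_norm 2 S (\<lambda>x. s n t x - v t x)) \<longlonglongrightarrow> 0"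
    then have vL: "v t \<in> L_space 2 S" and sL: "s n t \<in> L_space 2 S" for n
      using s(2) by blast+
    have "(\<lambda>n. b n t - (LINT x|lebesgue_on S. v t x * g x)) \<longlonglongrightarrow> 0"
    proof (rule Lim_null_comparison)
      show "(\<lambda>n. L_norm 2 S (\<lambda>x. s n t x - v t x) * L_norm 2 S g) \<longlonglongrightarrow> 0"
        using tendsto_mult_left_zero[OF conjunct2[OF t]] .
      have "\<bar>b n t - (LINT x|lebesgue_on S. v t x * g x)\<bar> \<le> L_norm 2 S (\<lambda>x. s n t x - v t x) * L_norm 2 S g" for n
      proof -
        have "b n t - (LINT x|lebesgue_on S. v t x * g x) = (LINT x|lebesgue_on S. (s n t x - v t x) * g x)"
          using L_space_2_mult_integrable[OF sL[of n] g] L_space_2_mult_integrable[OF vL g]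
          by (simp add: b_def left_diff_distrib)
        then show ?thesis
          using L_space_2_Cauchy_Schwarz_abs[OF L_space_2_diff[OF sL[of n] vL] g] by simp
      qed
      then show "\<forall>\<^sub>F n in sequentially. norm (b n t - (LINT x|lebesgue_on S. v t x * g x))
          \<le> L_norm 2 S (\<lambda>x. s n t x - v t x) * L_norm 2 S g" by simp
    qed
    then have "(\<lambda>n. b n t) \<longlonglongrightarrow> (LINT x|lebesgue_on S. v t x * g x)"
      by (simp add: LIM_zero_iff)
    then show "(LINT x|lebesgue_on S. v t x * g x) = lim (\<lambda>n. b n t)"
      by (simp add: limI)
  qed
  then show ?thesis
    by (rule borel_measurable_lebesgue_on_cong_AE[OF I borel_measurable_lim_metric[OF b]])
qed

lemma Bochner_L_2_norm_integrable:
  assumes I: "I \<in> lmeasurable" and v: "v \<in> Bochner_L 2 I (L_space 2 S) (L_norm 2 S)"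
  shows "integrable (lebesgue_on I) (\<lambda>t. L_norm 2 S (v t))"
proof -
  interpret finite_measure "lebesgue_on I" using I by (rule finite_measure_lebesgue_on)
  have int: "integrable (lebesgue_on I) (\<lambda>t. (L_norm 2 S (v t))\<^sup>2)"
    using v by (simp add: Bochner_L_def L_norm_2_nonneg)
  have "(\<lambda>t. sqrt ((L_norm 2 S (v t))\<^sup>2)) \<in> borel_measurable (lebesgue_on I)"
    using borel_measurable_integrable[OF int] by measurable
  then have m: "(\<lambda>t. L_norm 2 S (v t)) \<in> borel_measurable (lebesgue_on I)"
    by (simp add: L_norm_2_nonneg)
  have "integrable (lebesgue_on I) (\<lambda>t. 1 + (L_norm 2 S (v t))\<^sup>2)"
    using int by simp
  then show ?thesis
  proof (rule Bochner_Integration.integrable_bound)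
    have "r \<le> 1 + r\<^sup>2" for r :: real
    proof -
      have "2 * r \<le> r\<^sup>2 + 1" using zero_le_power2[of "r - 1"] by (simp add: power2_diff)
      then show ?thesis using zero_le_power2[of r] by linarith
    qed
    then show "AE t in lebesgue_on I. norm (L_norm 2 S (v t)) \<le> norm (1 + (L_norm 2 S (v t))\<^sup>2)"
      by (simp add: L_norm_2_nonneg)
  qed (rule m)
qed

lemma Bochner_inner_integrable:
  assumes I: "I \<in> lmeasurable" and v: "v \<in> Bochner_L 2 I (L_space 2 S) (L_norm 2 S)"
    and g: "g \<in> L_space 2 S"
  shows "integrable (lebesgue_on I) (\<lambda>t. LINT x|lebesgue_on S. v t x * g x)"
proof (rule Bochner_Integration.integrable_bound)
  show "integrable (lebesgue_on I) (\<lambda>t. L_norm 2 S (v t) * L_norm 2 S g)"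
    using Bochner_L_2_norm_integrable[OF I v] by simp
  have sm: "strongly_measurable I (L_space 2 S) (L_norm 2 S) v"
    using v by (simp add: Bochner_L_def)
  then show "(\<lambda>t. LINT x|lebesgue_on S. v t x * g x) \<in> borel_measurable (lebesgue_on I)"
    using I g by (intro Bochner_inner_measurable) auto
  have "AE t in lebesgue_on I. v t \<in> L_space 2 S"
    using sm unfolding strongly_measurable_def by (auto elim: eventually_mono)
  then show "AE t in lebesgue_on I. norm (LINT x|lebesgue_on S. v t x * g x) \<le> norm (L_norm 2 S (v t) * L_norm 2 S g)"
    by eventually_elim (use L_space_2_Cauchy_Schwarz_abs[OF _ g] in \<open>simp add: L_norm_2_nonneg\<close>)
qed

lemma L_norm_2_triangle:
  assumes "f \<in> L_space 2 S" "g \<in> L_space 2 S"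
  shows "L_norm 2 S (\<lambda>x. f x + g x) \<le> L_norm 2 S f + L_norm 2 S g"
proof (rule power2_le_imp_le)
  have "(L_norm 2 S (\<lambda>x. f x + g x))\<^sup>2 = (L_norm 2 S f)\<^sup>2 + (L_norm 2 S g)\<^sup>2 + 2 * (LINT x|lebesgue_on S. f x * g x)"
    using assms L_space_2_mult_integrable[OF assms]
    by (simp add: L_norm_2_power2 power2_sum L_space_2_iff mult.assoc)
  also have "\<dots> \<le> (L_norm 2 S f)\<^sup>2 + (L_norm 2 S g)\<^sup>2 + 2 * (L_norm 2 S f * L_norm 2 S g)"
    using L_space_2_Cauchy_Schwarz_abs[OF assms] by linarith
  finally show "(L_norm 2 S (\<lambda>x. f x + g x))\<^sup>2 \<le> (L_norm 2 S f + L_norm 2 S g)\<^sup>2"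
    by (simp add: power2_sum)
qed (simp add: L_norm_2_nonneg)

lemma L_norm_2_minus_commute:
  "L_norm 2 S (\<lambda>x. f x - g x) = L_norm 2 S (\<lambda>x. g x - f x)"
  by (simp add: L_norm_2 power2_commute)

lemma L_norm_2_triangle_diff:
  assumes "f \<in> L_space 2 S" "g \<in> L_space 2 S" "h \<in> L_space 2 S"
  shows "L_norm 2 S (\<lambda>x. f x - h x) \<le> L_norm 2 S (\<lambda>x. f x - g x) + L_norm 2 S (\<lambda>x. h x - g x)"
  using L_norm_2_triangle[OF L_space_2_diff[OF assms(1,2)] L_space_2_diff[OF assms(2,3)]]
  by (simp add: L_norm_2_minus_commute[of S h g])

lemma cutoff_primitive_integrable:
  assumes S: "S \<in> lmeasurable" and f: "f \<in> L_space 2 S" and M: "0 \<le> M"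
  shows "integrable (lebesgue_on S) (\<lambda>x. cutoff_primitive M (f x))"
proof -
  interpret finite_measure "lebesgue_on S" using S by (rule finite_measure_lebesgue_on)
  have "integrable (lebesgue_on S) (\<lambda>x. 1 + (f x)\<^sup>2)"
    using f by (simp add: L_space_2_iff)
  then show ?thesis
  proof (rule Bochner_Integration.integrable_bound)
    show "(\<lambda>x. cutoff_primitive M (f x)) \<in> borel_measurable (lebesgue_on S)"
      using f by (auto simp: L_space_2_iff intro: measurable_compose[OF _ cutoff_primitive_borel])
    have "\<bar>cutoff_primitive M r\<bar> \<le> 1 + r\<^sup>2" for r
    proof -
      have "\<bar>cutoff_primitive M r\<bar> \<le> \<bar>r\<bar>"
        using cutoff_primitive_lipschitz[of M r 0] M cutoff_primitive_eq_0_iff[of M 0] by simp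
      also have "\<dots> \<le> 1 + r\<^sup>2"
        using zero_le_power2[of "\<bar>r\<bar> - 1"] zero_le_power2[of "\<bar>r\<bar>"] unfolding power2_diff by simp
      finally show ?thesis .
    qed
    then show "AE x in lebesgue_on S. norm (cutoff_primitive M (f x)) \<le> norm (1 + (f x)\<^sup>2)"
      by simp
  qed
qed

lemma L_norm_2_continuous_into_tendsto:
  assumes u: "u \<in> continuous_into {0..} (L_space 2 S) (L_norm 2 S)" and t: "0 < t"
  shows "((\<lambda>s. L_norm 2 S (\<lambda>x. u s x - u t x)) \<longlongrightarrow> 0) (at t)"
proof -
  have "((\<lambda>s. L_norm 2 S (\<lambda>x. u s x - u t x)) \<longlongrightarrow> 0) (at t within {0..})"
    using u t by (simp add: continuous_into_def)
  then show ?thesis using t at_within_interior[of t "{0::real..}"] by simp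
qed

lemma inner_continuous_on:
  assumes u: "u \<in> continuous_into {0..} (L_space 2 S) (L_norm 2 S)" and g: "g \<in> L_space 2 S"
  shows "continuous_on {0<..} (\<lambda>t. LINT x|lebesgue_on S. u t x * g x)"
proof (rule continuous_at_imp_continuous_on, rule ballI)
  fix t :: real assume t: "t \<in> {0<..}"
  have uL: "u s \<in> L_space 2 S" if "s \<ge> 0" for s
    using u that by (simp add: continuous_into_def)
  let ?a = "\<lambda>t. LINT x|lebesgue_on S. u t x * g x"
  have "((\<lambda>s. ?a s - ?a t) \<longlongrightarrow> 0) (at t)"
  proof (rule Lim_null_comparison)
    show "((\<lambda>s. L_norm 2 S (\<lambda>x. u s x - u t x) * L_norm 2 S g) \<longlongrightarrow> 0) (at t)"
      using t by (intro tendsto_mult_left_zero L_norm_2_continuous_into_tendsto[OF u]) simp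
    have le: "\<bar>?a s - ?a t\<bar> \<le> L_norm 2 S (\<lambda>x. u s x - u t x) * L_norm 2 S g" if "s > 0" for s
    proof -
      have L: "u s \<in> L_space 2 S" "u t \<in> L_space 2 S" using uL that t by auto
      have "?a s - ?a t = (LINT x|lebesgue_on S. (u s x - u t x) * g x)"
        using L_space_2_mult_integrable[OF L(1) g] L_space_2_mult_integrable[OF L(2) g]
        by (simp add: left_diff_distrib)
      then show ?thesis
        using L_space_2_Cauchy_Schwarz_abs[OF L_space_2_diff[OF L] g] by simp
    qed
    have "\<forall>\<^sub>F s in at t. s \<in> {0<..}"
      using t by (intro eventually_at_in_open') auto
    then show "\<forall>\<^sub>F s in at t. norm (?a s - ?a t) \<le> L_norm 2 S (\<lambda>x. u s x - u t x) * L_norm 2 S g"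
      by (rule eventually_mono) (use le in auto)
  qed
  then show "isCont ?a t" by (simp add: isCont_def LIM_zero_iff)
qed

text \<open>The part of the argument that is independent of the equation: beyond regularity, all it uses is that
  testing \<open>u\<^sub>t\<close> with the cutoff of \<open>u\<close> gives a nonpositive value at almost every time.\<close>

locale energy_estimate =
  fixes S :: "'a::euclidean_space set" and u ut :: "real \<Rightarrow> 'a \<Rightarrow> real" and M :: real
  assumes S: "S \<in> lmeasurable"
    and u: "u \<in> continuous_into {0..} (L_space 2 S) (L_norm 2 S)"
    and ut: "\<And>\<delta> T. 0 < \<delta> \<Longrightarrow> \<delta> < T \<Longrightarrow> ut \<in> Bochner_L 2 {\<delta><..<T} (L_space 2 S) (L_norm 2 S)"
    and weak: "\<And>\<delta> T. 0 < \<delta> \<Longrightarrow> \<delta> < T \<Longrightarrow> has_weak_time_deriv S {\<delta><..<T} u ut"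
    and M: "0 \<le> M"
    and dissipative: "AE t in lebesgue_on {0<..}. (LINT x|lebesgue_on S. ut t x * cutoff M (u t x)) \<le> 0"
begin

definition energy :: "real \<Rightarrow> real" where
  "energy t = (LINT x|lebesgue_on S. cutoff_primitive M (u t x))"

lemma u_L_space: "0 \<le> t \<Longrightarrow> u t \<in> L_space 2 S"
  using u by (simp add: continuous_into_def)

lemma increment:
  assumes "0 < \<delta>" "\<delta> < s" "s < t" "t < T" and g: "g \<in> L_space 2 S"
  shows "(LINT x|lebesgue_on S. (u t x - u s x) * g x)
    = (LINT \<tau>|lebesgue_on {\<delta><..<T}. indicator {s<..t} \<tau> * (LINT x|lebesgue_on S. ut \<tau> x * g x))"
proof -
  have dT: "0 < \<delta>" "\<delta> < T" using assms by auto
  have "(LINT x|lebesgue_on S. u t x * g x) - (LINT x|lebesgue_on S. u s x * g x)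
      = (LINT \<tau>|lebesgue_on {\<delta><..<T}. indicator {s<..t} \<tau> * (LINT x|lebesgue_on S. ut \<tau> x * g x))"
  proof (rule weak_derivative_increment)
    show "continuous_on {\<delta><..<T} (\<lambda>t. LINT x|lebesgue_on S. u t x * g x)"
      using inner_continuous_on[OF u g] by (rule continuous_on_subset) (use assms in auto)
    show "integrable (lebesgue_on {\<delta><..<T}) (\<lambda>\<tau>. LINT x|lebesgue_on S. ut \<tau> x * g x)"
      using ut[OF dT] g by (intro Bochner_inner_integrable) auto
    show "(LINT x|lebesgue_on {\<delta><..<T}. deriv \<phi> x * (LINT xa|lebesgue_on S. u x xa * g xa))
        = - (LINT x|lebesgue_on {\<delta><..<T}. \<phi> x * (LINT xa|lebesgue_on S. ut x xa * g xa))"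
      if "\<phi> \<in> test_functions {\<delta><..<T}" for \<phi>
      using weak[OF dT] that g unfolding has_weak_time_deriv_def by blast
  qed (use assms in auto)
  moreover have "u t \<in> L_space 2 S" "u s \<in> L_space 2 S"
    using assms by (auto intro: u_L_space)
  ultimately show ?thesis
    using L_space_2_mult_integrable[OF _ g] by (simp add: left_diff_distrib)
qed

text \<open>By convexity the energy grows by at most the increment of \<open>u\<close> tested with the cutoff at the
  \<^emph>\<open>final\<close> time.  Replacing the final time by the running time costs only the modulus of continuity of
  \<open>u\<close>, and what remains is dissipative.\<close>

lemma energy_increment:
  assumes order: "0 < \<delta>" "\<delta> < s" "s < t" "t < T"
    and near: "\<And>\<tau>. s < \<tau> \<Longrightarrow> \<tau> \<le> t \<Longrightarrow> 27 * L_norm 2 S (\<lambda>x. u t x - u \<tau> x) \<le> e"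
  shows "energy t - energy s
    \<le> e * (LINT \<tau>|lebesgue_on {\<delta><..<T}. indicator {s<..t} \<tau> * L_norm 2 S (ut \<tau>))"
proof -
  let ?I = "{\<delta><..<T}"
  have dT: "0 < \<delta>" "\<delta> < T" using order by auto
  have uL: "u t \<in> L_space 2 S" "u s \<in> L_space 2 S"
    using order by (auto intro: u_L_space)
  let ?g = "\<lambda>x. cutoff M (u t x)"
  have g: "?g \<in> L_space 2 S" using uL(1) M by (rule L_space_2_cutoff)
  have "energy t - energy s = (LINT x|lebesgue_on S. cutoff_primitive M (u t x) - cutoff_primitive M (u s x))"
    using cutoff_primitive_integrable[OF S _ M] uL by (simp add: energy_def)
  also have "\<dots> \<le> (LINT x|lebesgue_on S. (u t x - u s x) * ?g x)"
  proof (rule integral_mono)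
    show "integrable (lebesgue_on S) (\<lambda>x. cutoff_primitive M (u t x) - cutoff_primitive M (u s x))"
      using cutoff_primitive_integrable[OF S _ M] uL by simp
    show "integrable (lebesgue_on S) (\<lambda>x. (u t x - u s x) * ?g x)"
      by (intro L_space_2_mult_integrable L_space_2_diff uL g)
    show "cutoff_primitive M (u t x) - cutoff_primitive M (u s x) \<le> (u t x - u s x) * ?g x" for x
      using cutoff_primitive_convex[of M "u t x" "u s x"] by (simp add: mult.commute)
  qed
  also have "\<dots> = (LINT \<tau>|lebesgue_on ?I. indicator {s<..t} \<tau> * (LINT x|lebesgue_on S. ut \<tau> x * ?g x))"
    using order g by (rule increment)
  also have "\<dots> \<le> (LINT \<tau>|lebesgue_on ?I. e * (indicator {s<..t} \<tau> * L_norm 2 S (ut \<tau>)))"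
  proof (rule integral_mono_AE)
    have ind: "integrable (lebesgue_on ?I) (\<lambda>\<tau>. indicator {s<..t} \<tau> * f \<tau>)"
      if "integrable (lebesgue_on ?I) f" for f :: "real \<Rightarrow> real"
    proof -
      have "{s<..t} \<in> sets (lebesgue_on ?I)"
        using order by (auto simp: sets_restrict_space_iff)
      from integrable_mult_indicator[OF this that] show ?thesis by simp
    qed
    show "integrable (lebesgue_on ?I) (\<lambda>\<tau>. indicator {s<..t} \<tau> * (LINT x|lebesgue_on S. ut \<tau> x * ?g x))"
      using ut[OF dT] g by (intro ind Bochner_inner_integrable) auto
    show "integrable (lebesgue_on ?I) (\<lambda>\<tau>. e * (indicator {s<..t} \<tau> * L_norm 2 S (ut \<tau>)))"
      using ut[OF dT] by (intro integrable_mult_right ind Bochner_L_2_norm_integrable) auto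
    have "AE \<tau> in lebesgue_on ?I. ut \<tau> \<in> L_space 2 S"
      using ut[OF dT] unfolding Bochner_L_def strongly_measurable_def by (auto elim: eventually_mono)
    moreover have "AE \<tau> in lebesgue_on ?I. (LINT x|lebesgue_on S. ut \<tau> x * cutoff M (u \<tau> x)) \<le> 0"
      using dissipative order by (auto simp: AE_restrict_space_iff elim!: eventually_mono)
    ultimately show "AE \<tau> in lebesgue_on ?I. indicator {s<..t} \<tau> * (LINT x|lebesgue_on S. ut \<tau> x * ?g x)
        \<le> e * (indicator {s<..t} \<tau> * L_norm 2 S (ut \<tau>))"
    proof eventually_elim
      fix \<tau>
      assume utL: "ut \<tau> \<in> L_space 2 S" and diss: "(LINT x|lebesgue_on S. ut \<tau> x * cutoff M (u \<tau> x)) \<le> 0"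
      show "indicator {s<..t} \<tau> * (LINT x|lebesgue_on S. ut \<tau> x * ?g x)
        \<le> e * (indicator {s<..t} \<tau> * L_norm 2 S (ut \<tau>))"
      proof (cases "\<tau> \<in> {s<..t}")
        case True
        then have \<tau>L: "u \<tau> \<in> L_space 2 S" using order by (intro u_L_space) auto
        then have g\<tau>: "(\<lambda>x. cutoff M (u \<tau> x)) \<in> L_space 2 S" using M by (rule L_space_2_cutoff)
        have "(LINT x|lebesgue_on S. ut \<tau> x * ?g x)
            = (LINT x|lebesgue_on S. ut \<tau> x * cutoff M (u \<tau> x))
              + (LINT x|lebesgue_on S. ut \<tau> x * (?g x - cutoff M (u \<tau> x)))"
          using L_space_2_mult_integrable[OF utL g] L_space_2_mult_integrable[OF utL g\<tau>]
          by (simp add: right_diff_distrib)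
        also have "\<dots> \<le> L_norm 2 S (ut \<tau>) * L_norm 2 S (\<lambda>x. ?g x - cutoff M (u \<tau> x))"
          using diss L_space_2_Cauchy_Schwarz_abs[OF utL L_space_2_diff[OF g g\<tau>]] by linarith
        also have "\<dots> \<le> L_norm 2 S (ut \<tau>) * e"
          using L_norm_2_cutoff_diff[OF uL(1) \<tau>L, of M] near[of \<tau>] True
          by (intro mult_left_mono L_norm_2_nonneg) auto
        finally show ?thesis using True by (simp add: mult.commute)
      qed simp
    qed
  qed
  finally show ?thesis by simp
qed

text \<open>The bound \<open>e * A \<alpha> \<beta>\<close> on the increment is additive over adjacent intervals and holds on short
  ones, hence on all; then \<open>e\<close> tends to zero.\<close>

lemma energy_nonincreasing:
  assumes \<alpha>\<beta>: "0 < \<alpha>" "\<alpha> \<le> \<beta>"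
  shows "energy \<beta> \<le> energy \<alpha>"
proof -
  define \<delta> where "\<delta> = \<alpha> / 2"
  define T where "T = \<beta> + 1"
  let ?I = "{\<delta><..<T}"
  have dT: "0 < \<delta>" "\<delta> < \<alpha>" "\<delta> < T" "\<beta> < T" using \<alpha>\<beta> by (auto simp: \<delta>_def T_def)
  define A where "A s t = (LINT \<tau>|lebesgue_on ?I. indicator {s<..t} \<tau> * L_norm 2 S (ut \<tau>))" for s t
  have A_int: "integrable (lebesgue_on ?I) (\<lambda>\<tau>. indicator {s<..t} \<tau> * L_norm 2 S (ut \<tau>))" for s t
  proof -
    have "{s<..t} \<inter> ?I \<in> sets (lebesgue_on ?I)"
      by (subst sets_restrict_space_iff) auto
    moreover have "integrable (lebesgue_on ?I) (\<lambda>\<tau>. L_norm 2 S (ut \<tau>))"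
      using ut[OF dT(1,3)] by (intro Bochner_L_2_norm_integrable) auto
    ultimately have "integrable (lebesgue_on ?I) (\<lambda>\<tau>. indicator ({s<..t} \<inter> ?I) \<tau> *\<^sub>R L_norm 2 S (ut \<tau>))"
      by (rule integrable_mult_indicator)
    then show ?thesis
      by (rule Bochner_Integration.integrable_cong[THEN iffD1, rotated 2]) (auto simp: indicator_def)
  qed
  have A_add: "A s t + A t r = A s r" if "s \<le> t" "t \<le> r" for s t r
  proof -
    have "A s t + A t r = (LINT \<tau>|lebesgue_on ?I. indicator {s<..t} \<tau> * L_norm 2 S (ut \<tau>)
        + indicator {t<..r} \<tau> * L_norm 2 S (ut \<tau>))"
      unfolding A_def using A_int by simp
    also have "\<dots> = A s r"
      unfolding A_def using that by (intro Bochner_Integration.integral_cong) (auto simp: indicator_def)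
    finally show ?thesis .
  qed
  have bound: "energy \<beta> - energy \<alpha> \<le> e * A \<alpha> \<beta>" if e: "e > 0" for e
    using \<alpha>\<beta>(2)
  proof (induction rule: Bolzano)
    case (trans a b c)
    have "energy c - energy a \<le> e * (A a b + A b c)"
      using trans(1,2) by (simp add: algebra_simps)
    then show ?case using A_add[OF trans(3,4)] by simp
  next
    case (local r)
    then have r: "\<delta> < r" "r < T" "0 < r" using dT by auto
    \<comment> \<open>Two times near \<open>r\<close> are compared through \<open>r\<close>, and the cutoff has Lipschitz constant \<open>27\<close>.\<close>
    have "\<forall>\<^sub>F s in at r. dist (L_norm 2 S (\<lambda>x. u s x - u r x)) 0 < e / 54"
      using e by (intro tendstoD[OF L_norm_2_continuous_into_tendsto[OF u r(3)]]) simp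
    then obtain d where d: "d > 0"
      "\<And>s. s \<noteq> r \<Longrightarrow> dist s r < d \<Longrightarrow> L_norm 2 S (\<lambda>x. u s x - u r x) < e / 54"
      by (auto simp: eventually_at L_norm_2_nonneg dist_real_def)
    have close: "L_norm 2 S (\<lambda>x. u s x - u r x) \<le> e / 54" if "\<bar>s - r\<bar> < d" for s
    proof (cases "s = r")
      case True
      then show ?thesis using e by (simp add: L_norm_2)
    next
      case False
      then show ?thesis using d(2)[of s] that by (simp add: dist_real_def)
    qed
    show ?case
    proof (intro exI[of _ "min d (min (r - \<delta>) (T - r))"] conjI allI impI)
      show "0 < min d (min (r - \<delta>) (T - r))" using d(1) r by simp
      fix a b assume ab: "a \<le> r \<and> r \<le> b \<and> b - a < min d (min (r - \<delta>) (T - r))"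
      then have lim: "\<delta> < a" "b < T" "a \<le> b" by auto
      show "energy b - energy a \<le> e * A a b"
      proof (cases "a = b")
        case True
        then show ?thesis by (simp add: A_def)
      next
        case False
        then have "a < b" using lim(3) by simp
        then show ?thesis
          unfolding A_def
        proof (rule energy_increment[OF dT(1) lim(1) _ lim(2)])
          fix \<tau> assume \<tau>: "a < \<tau>" "\<tau> \<le> b"
          have "u b \<in> L_space 2 S" "u \<tau> \<in> L_space 2 S" "u r \<in> L_space 2 S"
            using lim \<tau> dT(1) r by (auto intro!: u_L_space)
          from L_norm_2_triangle_diff[OF this(1,3,2)]
          have "L_norm 2 S (\<lambda>x. u b x - u \<tau> x)
              \<le> L_norm 2 S (\<lambda>x. u b x - u r x) + L_norm 2 S (\<lambda>x. u \<tau> x - u r x)" .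
          also have "\<dots> \<le> e / 54 + e / 54"
            using ab \<tau> by (intro add_mono close) auto
          finally show "27 * L_norm 2 S (\<lambda>x. u b x - u \<tau> x) \<le> e" by simp
        qed
      qed
    qed
  qed
  have "((\<lambda>e. e * A \<alpha> \<beta>) \<longlongrightarrow> 0 * A \<alpha> \<beta>) (at_right 0)"
    by (intro tendsto_intros)
  moreover have "\<forall>\<^sub>F e in at_right 0. energy \<beta> - energy \<alpha> \<le> e * A \<alpha> \<beta>"
    using bound by (auto simp: eventually_at_right_field intro: exI[of _ 1])
  ultimately have "energy \<beta> - energy \<alpha> \<le> 0 * A \<alpha> \<beta>"
    by (rule tendsto_lowerbound) simp
  then show ?thesis by simp
qed

lemma energy_tendsto_0:
  assumes init: "AE x in lebesgue_on S. u 0 x \<le> M"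
  shows "(energy \<longlongrightarrow> 0) (at_right 0)"
proof (rule Lim_null_comparison)
  interpret finite_measure "lebesgue_on S" using S by (rule finite_measure_lebesgue_on)
  have one: "(\<lambda>_. 1) \<in> L_space 2 S" by (simp add: L_space_2_iff)
  have u0: "u 0 \<in> L_space 2 S" by (rule u_L_space) simp
  have "((\<lambda>t. L_norm 2 S (\<lambda>x. u t x - u 0 x)) \<longlongrightarrow> 0) (at 0 within {0..})"
    using u by (simp add: continuous_into_def)
  then have "((\<lambda>t. L_norm 2 S (\<lambda>x. u t x - u 0 x)) \<longlongrightarrow> 0) (at_right 0)"
    by (rule tendsto_within_subset) auto
  then show "((\<lambda>t. L_norm 2 S (\<lambda>x. u t x - u 0 x) * L_norm 2 S (\<lambda>_. 1)) \<longlongrightarrow> 0) (at_right 0)"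
    by (rule tendsto_mult_left_zero)
  have "energy t \<le> L_norm 2 S (\<lambda>x. u t x - u 0 x) * L_norm 2 S (\<lambda>_. 1)" if "t > 0" for t
  proof -
    have ut: "u t \<in> L_space 2 S" using that by (intro u_L_space) simp
    have d: "(\<lambda>x. u t x - u 0 x) \<in> L_space 2 S" using ut u0 by (rule L_space_2_diff)
    have "energy t \<le> (LINT x|lebesgue_on S. \<bar>(u t x - u 0 x) * 1\<bar>)"
      unfolding energy_def
    proof (rule integral_mono_AE)
      show "integrable (lebesgue_on S) (\<lambda>x. cutoff_primitive M (u t x))"
        using S ut M by (rule cutoff_primitive_integrable)
      show "integrable (lebesgue_on S) (\<lambda>x. \<bar>(u t x - u 0 x) * 1\<bar>)"
        by (intro integrable_abs L_space_2_mult_integrable d one)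
      show "AE x in lebesgue_on S. cutoff_primitive M (u t x) \<le> \<bar>(u t x - u 0 x) * 1\<bar>"
        using init
      proof eventually_elim
        fix x assume "u 0 x \<le> M"
        then have "cutoff_primitive M (u 0 x) = 0" by (simp add: cutoff_primitive_eq_0_iff)
        then show "cutoff_primitive M (u t x) \<le> \<bar>(u t x - u 0 x) * 1\<bar>"
          using cutoff_primitive_lipschitz[of M "u t x" "u 0 x"] by simp
      qed
    qed
    also have "\<dots> \<le> L_norm 2 S (\<lambda>x. u t x - u 0 x) * L_norm 2 S (\<lambda>_. 1)"
      using d one by (rule L_space_2_Cauchy_Schwarz)
    finally show ?thesis .
  qed
  then show "\<forall>\<^sub>F t in at_right 0. norm (energy t) \<le> L_norm 2 S (\<lambda>x. u t x - u 0 x) * L_norm 2 S (\<lambda>_. 1)"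
    by (auto simp: eventually_at_right_field energy_def cutoff_primitive_nonneg intro: exI[of _ 1])
qed

lemma upper_bound:
  assumes init: "AE x in lebesgue_on S. u 0 x \<le> M" and t: "0 < t"
  shows "AE x in lebesgue_on S. u t x \<le> M"
proof -
  have "\<forall>\<^sub>F s in at_right 0. energy t \<le> energy s"
    using t by (auto simp: eventually_at_right_field intro!: exI[of _ t] energy_nonincreasing)
  with energy_tendsto_0[OF init] have "energy t \<le> 0"
    by (rule tendsto_lowerbound) simp
  moreover have "0 \<le> energy t" by (simp add: energy_def cutoff_primitive_nonneg)
  ultimately have "energy t = 0" by simp
  moreover have "integrable (lebesgue_on S) (\<lambda>x. cutoff_primitive M (u t x))"
    using t by (intro cutoff_primitive_integrable S M u_L_space) simp
  ultimately have "AE x in lebesgue_on S. cutoff_primitive M (u t x) = 0"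
    by (subst integral_nonneg_eq_0_iff_AE[symmetric]) (simp_all add: energy_def cutoff_primitive_nonneg)
  then show ?thesis by (simp add: cutoff_primitive_eq_0_iff)
qed

end

section \<open>Null sets of the cylinder and their time slices\<close>

text \<open>Lebesgue measure on the product is the completion of the product of Borel-Lebesgue measures, so
  slicing is done for Borel sets; a Lebesgue measurable set differs from one by a null set.\<close>

lemma lborel_null_iff_slices:
  fixes N :: "('a::euclidean_space \<times> real) set"
  assumes N: "N \<in> sets borel"
  shows "emeasure lborel N = 0 \<longleftrightarrow> (AE t in lborel. emeasure lborel ((\<lambda>x. (x, t)) -` N) = 0)"
proof -
  have N': "N \<in> sets (lborel \<Otimes>\<^sub>M lborel)" unfolding lborel_prod using N by simp
  have "emeasure lborel N = emeasure (lborel \<Otimes>\<^sub>M lborel) N" by (simp add: lborel_prod)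
  also have "\<dots> = (\<integral>\<^sup>+t. emeasure lborel ((\<lambda>x. (x, t)) -` N) \<partial>lborel)"
    using N' by (rule lborel_pair.emeasure_pair_measure_alt2)
  finally show ?thesis
    using lborel_pair.measurable_emeasure_Pair2[OF N'] by (simp add: nn_integral_0_iff_AE)
qed

lemma AE_cylinder_imp_slices:
  fixes S :: "'a::euclidean_space set"
  assumes S: "open S" and P: "AE p in lebesgue_on (cylinder S). P p"
  shows "AE t in lebesgue_on {0<..}. AE x in lebesgue_on S. P (x, t)"
proof -
  have "open (cylinder S)" using S by (intro open_Times) auto
  then have "cylinder S \<in> sets lebesgue" by auto
  then have "AE p in lebesgue. p \<in> cylinder S \<longrightarrow> P p"
    using P by (simp add: AE_restrict_space_iff)
  then have "AE p in lborel. p \<in> cylinder S \<longrightarrow> P p" by (simp only: AE_completion_iff)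
  then obtain N where N: "{p \<in> space lborel. \<not> (p \<in> cylinder S \<longrightarrow> P p)} \<subseteq> N"
    "emeasure lborel N = 0" "N \<in> sets lborel"
    by (rule AE_E)
  then have "AE t in lborel. emeasure lborel ((\<lambda>x. (x, t)) -` N) = 0"
    using lborel_null_iff_slices[of N] by simp
  then have "AE t in lebesgue. emeasure lborel ((\<lambda>x. (x, t)) -` N) = 0"
    by (rule AE_completion)
  then have "AE t in lebesgue. t \<in> {0<..} \<longrightarrow> (AE x in lebesgue_on S. P (x, t))"
  proof eventually_elim
    fix t :: real assume t: "emeasure lborel ((\<lambda>x. (x, t)) -` N) = 0"
    have "(\<lambda>x. (x, t)) -` N \<in> sets lborel"
      using N(3) measurable_sets[of "\<lambda>x. (x, t)" lborel lborel N] by simp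
    then have "AE x in lborel. x \<notin> (\<lambda>x. (x, t)) -` N"
      using t by (intro AE_not_in) (simp add: null_sets_def)
    then have "AE x in lebesgue. (x, t) \<notin> N"
      by (intro AE_completion) simp
    then have "AE x in lebesgue. x \<in> S \<longrightarrow> t \<in> {0<..} \<longrightarrow> P (x, t)"
      by eventually_elim (use N(1) in auto)
    then show "t \<in> {0<..} \<longrightarrow> (AE x in lebesgue_on S. P (x, t))"
      using S by (auto simp: AE_restrict_space_iff)
  qed
  then show ?thesis by (subst AE_restrict_space_iff) auto
qed

lemma AE_slices_imp_AE_lebesgue:
  fixes Q :: "('a::euclidean_space \<times> real) set"
  assumes Q: "Q \<in> sets lebesgue" and slices: "AE t in lebesgue. AE x in lebesgue. (x, t) \<notin> Q"
  shows "AE p in lebesgue. p \<notin> Q"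
proof -
  let ?A = "main_part lborel Q" and ?B = "null_part lborel Q"
  have A: "?A \<in> sets lborel" and Q_eq: "?A \<union> ?B = Q"
    using main_part_sets[OF Q] main_part_null_part_Un[OF Q] .
  have "AE t in lborel. emeasure lborel ((\<lambda>x. (x, t)) -` ?A) = 0"
    using slices unfolding AE_completion_iff
  proof eventually_elim
    fix t :: real assume "AE x in lborel. (x, t) \<notin> Q"
    then have "AE x in lborel. x \<notin> (\<lambda>x. (x, t)) -` ?A"
      by eventually_elim (use Q_eq in auto)
    moreover have "(\<lambda>x. (x, t)) -` ?A \<in> sets lborel"
      using A measurable_sets[of "\<lambda>x. (x, t)" lborel lborel ?A] by simp
    ultimately show "emeasure lborel ((\<lambda>x. (x, t)) -` ?A) = 0"
      using AE_iff_null_sets[of "(\<lambda>x. (x, t)) -` ?A" lborel] by auto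
  qed
  then have "emeasure lborel ?A = 0"
    using A lborel_null_iff_slices[of ?A] by simp
  then have "AE p in lborel. p \<notin> ?A"
    using A by (intro AE_not_in) (simp add: null_sets_def)
  moreover obtain N where "N \<in> null_sets lborel" "?B \<subseteq> N"
    using null_part[OF Q] by blast
  then have "AE p in lborel. p \<notin> ?B"
    using AE_not_in[of N lborel] by (auto elim: eventually_mono)
  ultimately have "AE p in lborel. p \<notin> Q"
    by eventually_elim (use Q_eq in blast)
  then show ?thesis by (rule AE_completion)
qed

lemma AE_imp_AE_cylinder:
  fixes S :: "'a::euclidean_space set"
  assumes S: "open S" and P: "AE x in lebesgue_on S. P x"
  shows "AE (x, t) in lebesgue_on (cylinder S). P x"
proof -
  have "S \<in> sets lebesgue" using S by auto
  then have "AE x in lebesgue. x \<in> S \<longrightarrow> P x"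
    using P by (simp add: AE_restrict_space_iff)
  then have "AE x in lborel. x \<in> S \<longrightarrow> P x" by (simp only: AE_completion_iff)
  then obtain N where N: "{x \<in> space lborel. \<not> (x \<in> S \<longrightarrow> P x)} \<subseteq> N"
    "emeasure lborel N = 0" "N \<in> sets lborel"
    by (rule AE_E)
  have N': "N \<times> (UNIV :: real set) \<in> sets borel"
    using N(3) by (simp add: borel_Times)
  have "(\<lambda>x. (x, t)) -` (N \<times> (UNIV :: real set)) = N" for t by auto
  then have "emeasure lborel (N \<times> (UNIV :: real set)) = 0"
    using N(2) by (simp add: lborel_null_iff_slices[OF N'])
  then have "AE p in lborel. p \<notin> N \<times> (UNIV :: real set)"
    using N' by (intro AE_not_in) (simp add: null_sets_def)
  then have "AE p in lebesgue. p \<notin> N \<times> (UNIV :: real set)"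
    by (rule AE_completion)
  then have "AE p in lebesgue. p \<in> cylinder S \<longrightarrow> (case p of (x, t) \<Rightarrow> P x)"
    by eventually_elim (use N(1) in auto)
  moreover have "open (cylinder S)" using S by (intro open_Times) auto
  then have "cylinder S \<in> sets lebesgue" by auto
  ultimately show ?thesis by (simp add: AE_restrict_space_iff)
qed

lemma AE_all_intervals_imp_AE_positive:
  assumes "\<And>\<delta> T. 0 < \<delta> \<Longrightarrow> \<delta> < T \<Longrightarrow> AE t in lebesgue_on {\<delta><..<T}. P t"
  shows "AE t in lebesgue_on {0::real<..}. P t"
proof -
  have "AE t in lebesgue. t \<in> {1 / real (Suc n)<..<real n + 2} \<longrightarrow> P t" for n
    using assms[of "1 / real (Suc n)" "real n + 2"]
    by (subst AE_restrict_space_iff[symmetric]) (auto simp: field_simps add_pos_nonneg)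
  then have "AE t in lebesgue. \<forall>n. t \<in> {1 / real (Suc n)<..<real n + 2} \<longrightarrow> P t"
    by (intro AE_all_countable[THEN iffD2] allI)
  then have "AE t in lebesgue. t \<in> {0<..} \<longrightarrow> P t"
  proof (rule eventually_mono, intro impI)
    fix t :: real
    assume all: "\<forall>n. t \<in> {1 / real (Suc n)<..<real n + 2} \<longrightarrow> P t" and t: "t \<in> {0<..}"
    obtain n where n: "max t (1 / t) \<le> real n" using real_arch_simple by blast
    then have "1 / t < real (Suc n)" by simp
    then have "1 / real (Suc n) < t" using t by (simp add: field_simps)
    moreover have "t < real n + 2" using n by simp
    ultimately show "P t" using all by auto
  qed
  then show ?thesis by (subst AE_restrict_space_iff) auto
qed

text \<open>The essential supremum is finite for functions in \<open>L\<^sup>\<infinity>\<close>, so its conversion to a real number loses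
  nothing.\<close>

lemma Linf_norm_bound:
  assumes "f \<in> Linf_space S"
  shows "AE x in lebesgue_on S. \<bar>f x\<bar> \<le> Linf_norm S f"
proof -
  let ?e = "esssup (lebesgue_on S) (\<lambda>x. ereal \<bar>f x\<bar>)"
  have m: "(\<lambda>x. ereal \<bar>f x\<bar>) \<in> borel_measurable (lebesgue_on S)"
    using assms by (auto simp: Linf_space_def)
  obtain C where "AE x in lebesgue_on S. \<bar>f x\<bar> \<le> C"
    using assms by (auto simp: Linf_space_def)
  then have "?e \<le> ereal C"
    using m by (intro esssup_I) auto
  then have fin: "?e \<noteq> \<infinity>" by auto
  have "AE x in lebesgue_on S. ereal \<bar>f x\<bar> \<le> ?e"
    by (rule esssup_AE)
  then show ?thesis
    unfolding Linf_norm_def using fin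
    by (auto elim!: eventually_mono) (cases ?e; auto)
qed

section \<open>The maximum principle\<close>

lemma subdiff_I_imp_ge: "s \<in> subdiff_I a r \<Longrightarrow> a \<le> r"
  by (auto simp: subdiff_I_def split: if_splits)

text \<open>Above the level \<open>M\<close> the solution has left the obstacle, so the constraint force vanishes there,
  and the reaction term is nonpositive because \<open>M \<ge> \<surd>\<kappa>\<close>.\<close>

lemma reaction_estimate:
  fixes M \<kappa> :: real
  assumes eq: "v + h - L + r ^ 3 - \<kappa> * r = 0" and h: "h \<in> subdiff_I a r"
    and a: "a \<le> M" and \<kappa>: "0 < \<kappa>" "sqrt \<kappa> \<le> M"
  shows "v * cutoff M r \<le> L * cutoff M r"
proof (cases "r \<le> M")
  case False
  then have "h = 0" using h a by (simp add: subdiff_I_def)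
  moreover have "\<kappa> * r \<le> r ^ 3"
  proof -
    have "sqrt \<kappa> \<le> r" "0 \<le> r" using False \<kappa> real_sqrt_gt_zero[of \<kappa>] by linarith+
    then have "(sqrt \<kappa>)\<^sup>2 \<le> r\<^sup>2" using \<kappa>(1) by (intro power_mono) auto
    then have "\<kappa> * r \<le> r\<^sup>2 * r" using \<open>0 \<le> r\<close> \<kappa>(1) by (intro mult_right_mono) auto
    then show ?thesis by (simp add: power3_eq_cube power2_eq_square)
  qed
  ultimately have "v \<le> L" using eq by simp
  then show ?thesis by (intro mult_right_mono cutoff_nonneg)
qed (simp add: cutoff_eq_0)

lemma dissipative_OP:
  fixes \<Omega> :: "'a::euclidean_space set"
  assumes \<Omega>: "open \<Omega>" and \<kappa>: "0 < \<kappa>" "sqrt \<kappa> \<le> M"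
    and data: "solution_data \<Omega> \<kappa> u0 u ut Lu \<eta>"
    and obstacle: "AE (x, t) in lebesgue_on (cylinder \<Omega>). \<eta> t x \<in> subdiff_I (u0 x) (u t x)"
    and u0: "AE x in lebesgue_on \<Omega>. u0 x \<le> M"
  shows "AE t in lebesgue_on {0<..}. (LINT x|lebesgue_on \<Omega>. ut t x * cutoff M (u t x)) \<le> 0"
proof -
  have M: "0 \<le> M" using \<kappa> real_sqrt_gt_zero[of \<kappa>] by linarith
  have reg: "regular \<Omega> u" and td: "is_time_deriv \<Omega> u ut" and lap: "is_laplacian \<Omega> u Lu"
    and eq: "AE (x, t) in lebesgue_on (cylinder \<Omega>). ut t x + \<eta> t x - Lu t x + u t x ^ 3 - \<kappa> * u t x = 0"
    and cont: "u \<in> continuous_into {0..} (L_space 2 \<Omega>) (L_norm 2 \<Omega>)"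
    using data by (auto simp: solution_data_def)
  have H10: "u t \<in> H10_space \<Omega>" if "t > 0" for t
  proof -
    have "0 < t / 2 \<and> t / 2 < t" using that by simp
    then have "u \<in> continuous_into {t / 2..t} (H10_space \<Omega> \<inter> L_space 4 \<Omega>) (\<lambda>f. H1_norm \<Omega> f + L_norm 4 \<Omega> f)"
      using reg unfolding regular_def by blast
    then show ?thesis using that by (auto simp: continuous_into_def)
  qed
  have "AE t in lebesgue_on {0<..}. u t \<in> H2_space \<Omega>"
  proof (rule AE_all_intervals_imp_AE_positive)
    fix \<delta> T :: real assume "0 < \<delta>" "\<delta> < T"
    then have "u \<in> Bochner_L 2 {\<delta><..<T} (H2_space \<Omega>) (H2_norm \<Omega>)"
      using reg unfolding regular_def by blast
    then show "AE t in lebesgue_on {\<delta><..<T}. u t \<in> H2_space \<Omega>"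
      unfolding Bochner_L_def strongly_measurable_def by (auto elim: eventually_mono)
  qed
  moreover have "AE t in lebesgue_on {0<..}. ut t \<in> L_space 2 \<Omega>"
  proof (rule AE_all_intervals_imp_AE_positive)
    fix \<delta> T :: real assume "0 < \<delta>" "\<delta> < T"
    then have "ut \<in> Bochner_L 2 {\<delta><..<T} (L_space 2 \<Omega>) (L_norm 2 \<Omega>)"
      using td unfolding is_time_deriv_def by blast
    then show "AE t in lebesgue_on {\<delta><..<T}. ut t \<in> L_space 2 \<Omega>"
      unfolding Bochner_L_def strongly_measurable_def by (auto elim: eventually_mono)
  qed
  moreover have "AE t in lebesgue_on {0<..}. AE x in lebesgue_on \<Omega>. Lu t x = laplacian \<Omega> (u t) x"
    using lap by (simp add: is_laplacian_def)
  moreover have "AE t in lebesgue_on {0<..}. AE x in lebesgue_on \<Omega>.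
      ut t x + \<eta> t x - Lu t x + u t x ^ 3 - \<kappa> * u t x = 0"
    using AE_cylinder_imp_slices[OF \<Omega> eq] by simp
  moreover have "AE t in lebesgue_on {0<..}. AE x in lebesgue_on \<Omega>. \<eta> t x \<in> subdiff_I (u0 x) (u t x)"
    using AE_cylinder_imp_slices[OF \<Omega> obstacle] by simp
  moreover have "AE t in lebesgue_on {0::real<..}. t > 0"
    using AE_space[of "lebesgue_on {0::real<..}"] by (auto elim: eventually_mono)
  ultimately show ?thesis
  proof eventually_elim
    fix t :: real
    assume H2: "u t \<in> H2_space \<Omega>" and utL: "ut t \<in> L_space 2 \<Omega>"
      and L: "AE x in lebesgue_on \<Omega>. Lu t x = laplacian \<Omega> (u t) x"
      and e: "AE x in lebesgue_on \<Omega>. ut t x + \<eta> t x - Lu t x + u t x ^ 3 - \<kappa> * u t x = 0"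
      and o: "AE x in lebesgue_on \<Omega>. \<eta> t x \<in> subdiff_I (u0 x) (u t x)" and t: "t > 0"
    have "u t \<in> L_space 2 \<Omega>" using cont t by (simp add: continuous_into_def)
    then have g: "(\<lambda>x. cutoff M (u t x)) \<in> L_space 2 \<Omega>" using M by (rule L_space_2_cutoff)
    have "(LINT x|lebesgue_on \<Omega>. ut t x * cutoff M (u t x))
        \<le> (LINT x|lebesgue_on \<Omega>. laplacian \<Omega> (u t) x * cutoff M (u t x))"
    proof (rule integral_mono_AE)
      show "AE x in lebesgue_on \<Omega>. ut t x * cutoff M (u t x) \<le> laplacian \<Omega> (u t) x * cutoff M (u t x)"
        using L e o u0
      proof eventually_elim
        fix x
        assume "Lu t x = laplacian \<Omega> (u t) x"
          and "ut t x + \<eta> t x - Lu t x + u t x ^ 3 - \<kappa> * u t x = 0"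
          and "\<eta> t x \<in> subdiff_I (u0 x) (u t x)" and "u0 x \<le> M"
        then show "ut t x * cutoff M (u t x) \<le> laplacian \<Omega> (u t) x * cutoff M (u t x)"
          using reaction_estimate[of "ut t x" "\<eta> t x" "Lu t x" "u t x" \<kappa> "u0 x" M] \<kappa> by simp
      qed
    qed (intro L_space_2_mult_integrable utL g laplacian_L_space_2 \<Omega> H2)+
    also have "\<dots> \<le> 0"
      using \<Omega> H2 H10[OF t] M by (rule integral_laplacian_cutoff_nonpos)
    finally show "(LINT x|lebesgue_on \<Omega>. ut t x * cutoff M (u t x)) \<le> 0" .
  qed
qed

text \<open>The energy argument gives the upper bound at every positive time; joint measurability of \<open>u\<close> turns
  this into a bound almost everywhere in the cylinder.\<close>

lemma maximum_principle_OP: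
  fixes \<Omega> :: "'a::euclidean_space set"
  assumes \<Omega>: "open \<Omega>" "bounded \<Omega>" and \<kappa>: "0 < \<kappa>" "sqrt \<kappa> \<le> M"
    and OP: "solves_OP \<Omega> \<kappa> u0 u" and u0: "AE x in lebesgue_on \<Omega>. u0 x \<le> M"
  shows "AE (x, t) in lebesgue_on (cylinder \<Omega>). u0 x \<le> u t x \<and> u t x \<le> M"
proof -
  have M: "0 \<le> M" using \<kappa> real_sqrt_gt_zero[of \<kappa>] by linarith
  obtain ut Lu \<eta> where data: "solution_data \<Omega> \<kappa> u0 u ut Lu \<eta>"
    and obstacle: "AE (x, t) in lebesgue_on (cylinder \<Omega>). \<eta> t x \<in> subdiff_I (u0 x) (u t x)"
    using OP by (auto simp: solves_OP_def)
  have meas: "(\<lambda>(x, t). u t x) \<in> borel_measurable (lebesgue_on (cylinder \<Omega>))"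
    and td: "is_time_deriv \<Omega> u ut"
    and cont: "u \<in> continuous_into {0..} (L_space 2 \<Omega>) (L_norm 2 \<Omega>)"
    and init: "AE x in lebesgue_on \<Omega>. u 0 x = u0 x"
    using data by (auto simp: solution_data_def jointly_measurable_def)
  interpret energy_estimate \<Omega> u ut M
  proof
    show "\<Omega> \<in> lmeasurable" using \<Omega> by (intro lmeasurable_open)
    show "ut \<in> Bochner_L 2 {\<delta><..<T} (L_space 2 \<Omega>) (L_norm 2 \<Omega>)" if "0 < \<delta>" "\<delta> < T" for \<delta> T
      using td that by (simp add: is_time_deriv_def)
    show "has_weak_time_deriv \<Omega> {\<delta><..<T} u ut" if "0 < \<delta>" "\<delta> < T" for \<delta> T
      using td that by (simp add: is_time_deriv_def)
    show "AE t in lebesgue_on {0<..}. (LINT x|lebesgue_on \<Omega>. ut t x * cutoff M (u t x)) \<le> 0"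
      using \<Omega>(1) \<kappa> data obstacle u0 by (rule dissipative_OP)
  qed (fact cont M)+
  have "AE x in lebesgue_on \<Omega>. u 0 x \<le> M"
    using init u0 by eventually_elim simp
  then have slice: "AE x in lebesgue_on \<Omega>. u t x \<le> M" if "0 < t" for t
    using that by (rule upper_bound)
  have "open (cylinder \<Omega>)" using \<Omega>(1) by (intro open_Times) auto
  then have cyl: "cylinder \<Omega> \<in> sets lebesgue" by auto
  define Q where "Q = {p \<in> cylinder \<Omega>. M < (case p of (x, t) \<Rightarrow> u t x)}"
  have "{p \<in> space (lebesgue_on (cylinder \<Omega>)). M < (case p of (x, t) \<Rightarrow> u t x)} \<in> sets (lebesgue_on (cylinder \<Omega>))"
    using meas by (intro borel_measurable_less) auto
  then have Q: "Q \<in> sets lebesgue"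
    using cyl by (simp add: Q_def sets_restrict_space_iff)
  have "AE p in lebesgue. p \<notin> Q"
  proof (rule AE_slices_imp_AE_lebesgue[OF Q], rule AE_I2)
    fix t :: real
    show "AE x in lebesgue. (x, t) \<notin> Q"
    proof (cases "0 < t")
      case True
      have "\<Omega> \<in> sets lebesgue" using \<Omega>(1) by auto
      then have "AE x in lebesgue. x \<in> \<Omega> \<longrightarrow> u t x \<le> M"
        using slice[OF True] by (simp add: AE_restrict_space_iff)
      then show ?thesis by eventually_elim (auto simp: Q_def)
    qed (simp add: Q_def)
  qed
  then have "AE p in lebesgue_on (cylinder \<Omega>). p \<notin> Q"
    using cyl by (auto simp: AE_restrict_space_iff elim: eventually_mono)
  moreover have "AE p in lebesgue_on (cylinder \<Omega>). p \<in> cylinder \<Omega>"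
    using AE_space[of "lebesgue_on (cylinder \<Omega>)"] by (rule eventually_mono) simp
  ultimately show ?thesis
    using obstacle
  proof eventually_elim
    fix p
    assume "p \<notin> Q" "p \<in> cylinder \<Omega>" "case p of (x, t) \<Rightarrow> \<eta> t x \<in> subdiff_I (u0 x) (u t x)"
    then show "case p of (x, t) \<Rightarrow> u0 x \<le> u t x \<and> u t x \<le> M"
      by (cases p) (auto simp: Q_def not_less dest: subdiff_I_imp_ge)
  qed
qed

theorem corollary6p3:
  fixes \<Omega> :: "(real ^ 'n) set" and \<kappa> r :: real
    and u0 :: "real ^ 'n \<Rightarrow> real" and u :: "real \<Rightarrow> real ^ 'n \<Rightarrow> real"
  assumes "smooth_bounded_domain \<Omega>" and "\<kappa> > 0" and "r > 0"
    and "u0 \<in> closure_wrt (L_space 2 \<Omega>) (L_norm 2 \<Omega>) (D_set \<Omega> \<kappa> r)"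
    and "solves_P \<Omega> \<kappa> u0 u" and "solves_OP \<Omega> \<kappa> u0 u"
    and "u0 \<in> Linf_space \<Omega>"
  shows "(AE (x, t) in lebesgue_on (cylinder \<Omega>).
            u0 x \<le> u t x \<and> u t x \<le> max (sqrt \<kappa>) (Linf_norm \<Omega> u0))
       \<and> (\<lambda>(x, t). u t x) \<in> Linf_space (cylinder \<Omega>)"
proof
  let ?M = "max (sqrt \<kappa>) (Linf_norm \<Omega> u0)"
  have \<Omega>: "open \<Omega>" "bounded \<Omega>"
    using assms(1) by (auto simp: smooth_bounded_domain_def)
  have u0: "AE x in lebesgue_on \<Omega>. \<bar>u0 x\<bar> \<le> Linf_norm \<Omega> u0"
    using assms(7) by (rule Linf_norm_bound)
  show bounds: "AE (x, t) in lebesgue_on (cylinder \<Omega>). u0 x \<le> u t x \<and> u t x \<le> ?M"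
  proof (rule maximum_principle_OP[OF \<Omega> assms(2) _ assms(6)])
    show "AE x in lebesgue_on \<Omega>. u0 x \<le> ?M" using u0 by eventually_elim simp
  qed simp
  have "AE p in lebesgue_on (cylinder \<Omega>). \<bar>case p of (x, t) \<Rightarrow> u t x\<bar> \<le> ?M"
    using bounds AE_imp_AE_cylinder[OF \<Omega>(1) u0]
  proof eventually_elim
    fix p :: "(real ^ 'n) \<times> real"
    assume "case p of (x, t) \<Rightarrow> u0 x \<le> u t x \<and> u t x \<le> ?M"
      and "case p of (x, t) \<Rightarrow> \<bar>u0 x\<bar> \<le> Linf_norm \<Omega> u0"
    then show "\<bar>case p of (x, t) \<Rightarrow> u t x\<bar> \<le> ?M"
      by (cases p) auto
  qed
  moreover have "jointly_measurable \<Omega> u"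
    using assms(6) by (auto simp: solves_OP_def solution_data_def)
  ultimately show "(\<lambda>(x, t). u t x) \<in> Linf_space (cylinder \<Omega>)"
    unfolding Linf_space_def jointly_measurable_def by blast
qed

end
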